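(* Let $n,m$ be positive integers, $d=n+m$, $\Theta$ a real $n\times m$ matrix with transpose ${}^t\Theta$, and $X,U>0$. Suppose there exists $(\mathbf x,\mathbf y)\in\mathbb Z^m\times\mathbb Z^n$, $(\mathbf x,\mathbf y)\neq(\mathbf 0,\mathbf 0)$, with $|\mathbf x|_\infty\leq X$ and $|\Theta\mathbf x+\mathbf y|_\infty\leq U$. Then there exists $(\mathbf x,\mathbf y)\in\mathbb Z^m\times\mathbb Z^n$, $(\mathbf x,\mathbf y)\neq(\mathbf 0,\mathbf 0)$, with $|\mathbf y|_\infty\leq Y$ and $|\mathbf x-{}^t\Theta\mathbf y|_\infty\leq V$, where \[ Y=\Delta_d^{-\frac1{d-1}}\big(X^mU^{1-m}\big)^{\frac1{d-1}},\qquad V=\Delta_d^{-\frac1{d-1}}\big(X^{1-n}U^n\big)^{\frac1{d-1}}. \]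
   Context: $|\cdot|_\infty$ is the sup-norm. $\Delta_d=\frac{1}{2^{d-1}\sqrt d}\,\mathrm{vol}_{d-1}\{\mathbf x\in[-1,1]^d : \sum_{i=1}^d x_i=0\}$, where $\mathrm{vol}_{d-1}$ is $(d-1)$-dimensional Lebesgue measure. *)

theory Defs
  imports "HOL-Analysis.Analysis"
begin

definition orthonormal_basis_of :: "'a::euclidean_space set \<Rightarrow> 'a set \<Rightarrow> bool" where
  "orthonormal_basis_of S B \<longleftrightarrow> pairwise orthogonal B \<and> (\<forall>b\<in>B. norm b = 1) \<and> span B = S"

(* The dim S-dimensional Lebesgue (Borel) measure on a linear subspace S, as a measure on the
   ambient space. It copies the library's construction of lborel, with Basis replaced by an
   orthonormal basis of S. By rotation invariance it does not depend on the basis chosen. *)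
definition subspace_lborel :: "'a::euclidean_space set \<Rightarrow> 'a measure" where
  "subspace_lborel S =
    (let B = (SOME B. orthonormal_basis_of S B)
     in distr (\<Pi>\<^sub>M b\<in>B. lborel) borel (\<lambda>f. \<Sum>b\<in>B. f b *\<^sub>R b))"

(* The constant Delta_d depends only on d, which is passed as an index type of cardinality d. *)
definition Delta :: "'k::finite itself \<Rightarrow> real" where
  "Delta _ = 1 / (2 ^ (CARD('k) - 1) * sqrt (real CARD('k))) *
     measure (subspace_lborel {x :: real^'k. (\<Sum>i\<in>UNIV. x $ i) = 0})
       {x :: real^'k. (\<forall>i. x $ i \<in> {-1..1}) \<and> (\<Sum>i\<in>UNIV. x $ i) = 0}"

definition int_vecs :: "(real^'k::finite) set" where
  "int_vecs = {x. \<forall>i. x $ i \<in> \<int>}"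

end

theory Submission
  imports Defs
begin

text \<open>
  Let \<open>v = (x, y)\<close> be the given lattice point. Since
  \<open>x \<bullet> x' + y \<bullet> y' = x \<bullet> (x' - \<Theta>\<^sup>T y') + (\<Theta> x + y) \<bullet> y'\<close>, the substitution
  \<open>(x' - \<Theta>\<^sup>T y', y') = (V a, Y b)\<close> turns the slab \<open>\<bar>v \<bullet> (x', y')\<bar> < \<epsilon>\<close> in the
  body of admissible points into a slab of a cube whose normal vector \<open>(V x, Y (\<Theta> x + y))\<close> has all
  entries at most \<open>R = V X = Y U\<close>. The convolution of a symmetric unimodal function with an
  interval is again symmetric and unimodal. Hence the volume of such a slab decreases in the absolute
  value of each entry of the normal vector and is least for the normal vector \<open>(R, ..., R)\<close>, where
  it is governed by \<open>\<Delta>\<close>. The identity \<open>V\<^sup>m Y\<^sup>n \<Delta> = R\<close> makes the slabs just large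
  enough for Blichfeldt's pigeonhole principle applied to translates of a thin slab along a vector
  \<open>u\<close> for which \<open>u \<bullet> v\<close> is the least positive inner product of \<open>v\<close> with a lattice vector. The
  boundary case is reached by enlarging the body by \<open>1 + \<delta>\<close> and letting \<open>\<delta>\<close> tend to 0, as only
  finitely many lattice points compete.
\<close>

subsection \<open>Slabs of cubes\<close>

text \<open>With \<open>c = (t' - t) / a\<close>, the parts of the two windows of integration outside their
  intersection are exchanged by the reflection \<open>s \<mapsto> c - s\<close>, which moves \<open>t + a * s\<close> away from the origin.\<close>
lemma nn_integral_shift_unimodal_le:
  fixes f :: "real \<Rightarrow> ennreal"
  assumes [measurable]: "f \<in> borel_measurable borel"
    and f: "\<And>x y. \<bar>x\<bar> \<le> \<bar>y\<bar> \<Longrightarrow> f y \<le> f x"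
    and t: "0 \<le> t" "t \<le> t'" and a: "0 < a"
  shows "(\<integral>\<^sup>+ s. indicator {-r..r} s * f (t' + a * s) \<partial>lborel)
       \<le> (\<integral>\<^sup>+ s. indicator {-r..r} s * f (t + a * s) \<partial>lborel)"
proof -
  define c where "c = (t' - t) / a"
  have c: "c \<ge> 0" "t' = t + a * c" using t a by (auto simp: c_def field_simps)
  let ?J = "{-r..r}" and ?J' = "{c-r..c+r}"
  let ?g = "\<lambda>s. f (t + a * s)"
  have "(\<integral>\<^sup>+ s. indicator ?J s * f (t' + a * s) \<partial>lborel)
      = (\<integral>\<^sup>+ s. indicator ?J' s * ?g s \<partial>lborel)"
    by (subst (2) nn_integral_real_affine[of _ 1 c])
       (auto simp: c algebra_simps indicator_def intro!: nn_integral_cong)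
  also have "\<dots> = (\<integral>\<^sup>+ s. indicator (?J \<inter> ?J') s * ?g s + indicator (?J' - ?J) s * ?g s \<partial>lborel)"
    by (intro nn_integral_cong) (auto simp: indicator_def)
  also have "\<dots> = (\<integral>\<^sup>+ s. indicator (?J \<inter> ?J') s * ?g s \<partial>lborel) +
                  (\<integral>\<^sup>+ s. indicator (?J' - ?J) s * ?g s \<partial>lborel)"
    by (intro nn_integral_add) auto
  finally have left: "(\<integral>\<^sup>+ s. indicator ?J s * f (t' + a * s) \<partial>lborel)
      = (\<integral>\<^sup>+ s. indicator (?J \<inter> ?J') s * ?g s \<partial>lborel) +
        (\<integral>\<^sup>+ s. indicator (?J' - ?J) s * ?g s \<partial>lborel)" .
  have "(\<integral>\<^sup>+ s. indicator (?J' - ?J) s * ?g s \<partial>lborel)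
      = (\<integral>\<^sup>+ s. indicator (?J' - ?J) (c - s) * ?g (c - s) \<partial>lborel)"
    by (subst nn_integral_real_affine[of _ "-1" c]) auto
  also have "\<dots> \<le> (\<integral>\<^sup>+ s. indicator (?J - ?J') s * ?g s \<partial>lborel)"
  proof (intro nn_integral_mono)
    fix s
    show "indicator (?J' - ?J) (c - s) * ?g (c - s) \<le> indicator (?J - ?J') s * ?g s"
    proof (cases "c - s \<in> ?J' - ?J")
      case True
      hence s: "s \<in> ?J - ?J'" by auto
      hence "s \<le> c - s" using c by auto
      hence *: "a * s \<le> a * (c - s)" using a by simp
      have "t + a * s + (t + a * (c - s)) = t + t'" by (simp add: c algebra_simps)
      hence "\<bar>t + a * s\<bar> \<le> \<bar>t + a * (c - s)\<bar>" using * t by linarith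
      thus ?thesis using s by (auto intro: f)
    qed auto
  qed
  finally have right: "(\<integral>\<^sup>+ s. indicator (?J' - ?J) s * ?g s \<partial>lborel)
      \<le> (\<integral>\<^sup>+ s. indicator (?J - ?J') s * ?g s \<partial>lborel)" .
  have "(\<integral>\<^sup>+ s. indicator (?J \<inter> ?J') s * ?g s \<partial>lborel) +
         (\<integral>\<^sup>+ s. indicator (?J - ?J') s * ?g s \<partial>lborel)
     = (\<integral>\<^sup>+ s. indicator (?J \<inter> ?J') s * ?g s + indicator (?J - ?J') s * ?g s \<partial>lborel)"
    by (intro nn_integral_add[symmetric]) auto
  also have "\<dots> = (\<integral>\<^sup>+ s. indicator ?J s * ?g s \<partial>lborel)"
    by (intro nn_integral_cong) (auto simp: indicator_def)
  finally show ?thesis unfolding left using add_left_mono[OF right] by (rule ord_le_eq_trans[rotated])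
qed

text \<open>The reflection \<open>s \<mapsto> -s\<close> of the window changes the sign of
  \<open>a\<close>, and evenness of \<open>f\<close> allows \<open>t\<close> and \<open>a\<close> to
  change sign together. So both may be replaced by their absolute values, which is the case of the
  preceding lemma; that lemma divides by \<open>a\<close>, so \<open>a = 0\<close> is treated
  apart.\<close>

lemma unimodal_convolution_le:
  fixes f :: "real \<Rightarrow> ennreal"
  assumes [measurable]: "f \<in> borel_measurable borel"
    and f: "\<And>x y. \<bar>x\<bar> \<le> \<bar>y\<bar> \<Longrightarrow> f y \<le> f x"
    and t: "\<bar>t\<bar> \<le> \<bar>t'\<bar>"
  shows "(\<integral>\<^sup>+ s. indicator {-r..r} s * f (t' + a * s) \<partial>lborel)
       \<le> (\<integral>\<^sup>+ s. indicator {-r..r} s * f (t + a * s) \<partial>lborel)"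
proof -
  define h where "h = (\<lambda>t a. \<integral>\<^sup>+ s. indicator {-r..r} s * f (t + a * s) \<partial>lborel)"
  have h1: "h t (-a) = h t a" for t a
    unfolding h_def
    by (subst nn_integral_real_affine[of _ "-1" 0]) (auto simp: indicator_def intro!: nn_integral_cong)
  have f_abs: "f x = f y" if "\<bar>x\<bar> = \<bar>y\<bar>" for x y
    using f[of x y] f[of y x] that by (intro antisym) auto
  have h2: "h (-t) (-a) = h t a" for t a
    unfolding h_def by (intro nn_integral_cong arg_cong2[of _ _ _ _ "(*)"] f_abs refl)
       (simp add: abs_minus_commute flip: abs_minus_cancel[of "t + a * _"])
  have h3: "h t a = h \<bar>t\<bar> \<bar>a\<bar>" for t a
    using h1[of t a] h2[of t a] h1[of "-t" a] by (auto simp: abs_if)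
  have "h \<bar>t'\<bar> \<bar>a\<bar> \<le> h \<bar>t\<bar> \<bar>a\<bar>"
  proof (cases "a = 0")
    case True
    thus ?thesis using t by (auto simp: h_def intro!: nn_integral_mono mult_left_mono f)
  next
    case False
    thus ?thesis unfolding h_def using t by (intro nn_integral_shift_unimodal_le) (auto intro: f)
  qed
  thus ?thesis using h3[of t a] h3[of t' a] by (simp add: h_def)
qed

text \<open>This is the volume of the part of the cube of half-side \<open>r\<close> in an open slab
  of half-width \<open>\<eta>\<close>. The offset \<open>t\<close> makes induction on
  \<open>I\<close> possible: integrating out one coordinate only shifts \<open>t\<close>.\<close>

definition slab :: "real \<Rightarrow> real \<Rightarrow> 'i set \<Rightarrow> ('i \<Rightarrow> real) \<Rightarrow> real \<Rightarrow> ennreal" where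
  "slab r \<eta> I w t = (\<integral>\<^sup>+ c. (\<Prod>i\<in>I. indicator {-r..r} (c i)) *
     indicator {-\<eta><..<\<eta>} (t + (\<Sum>i\<in>I. w i * c i)) \<partial>(\<Pi>\<^sub>M i\<in>I. lborel))"

lemma slab_empty: "slab r \<eta> {} w t = indicator {-\<eta><..<\<eta>} t"
  by (simp add: slab_def PiM_empty nn_integral_count_space_finite)

lemma slab_insert:
  assumes "finite I" "j \<notin> I"
  shows "slab r \<eta> (insert j I) w t =
    (\<integral>\<^sup>+ s. indicator {-r..r} s * slab r \<eta> I w (t + w j * s) \<partial>lborel)"
proof -
  interpret product_sigma_finite "\<lambda>_::'a. lborel :: real measure" ..
  have eq: "(\<Prod>i\<in>I. indicator {-r..r} ((x(j := y)) i) :: ennreal) = (\<Prod>i\<in>I. indicator {-r..r} (x i))"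
    "(\<Sum>i\<in>I. w i * (x(j := y)) i) = (\<Sum>i\<in>I. w i * x i)" for x :: "'a \<Rightarrow> real" and y
    using assms by (auto intro!: prod.cong sum.cong)
  have 1: "(\<lambda>c. (\<Prod>i\<in>insert j I. indicator {-r..r} (c i) :: ennreal) *
     indicator {-\<eta><..<\<eta>} (t + (\<Sum>i\<in>insert j I. w i * c i))) \<in> borel_measurable (\<Pi>\<^sub>M i\<in>insert j I. lborel)"
    by measurable
  show ?thesis
    unfolding slab_def
  proof (subst product_nn_integral_insert_rev[OF assms 1], intro nn_integral_cong)
    fix s
    have 2: "(\<lambda>c. (\<Prod>i\<in>I. indicator {-r..r} (c i) :: ennreal) *
       indicator {-\<eta><..<\<eta>} (t + w j * s + (\<Sum>i\<in>I. w i * c i))) \<in> borel_measurable (\<Pi>\<^sub>M i\<in>I. lborel)"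
      by measurable
    show "(\<integral>\<^sup>+ x. (\<Prod>i\<in>insert j I. indicator {-r..r} ((x(j := s)) i)) *
        indicator {-\<eta><..<\<eta>} (t + (\<Sum>i\<in>insert j I. w i * (x(j := s)) i)) \<partial>(\<Pi>\<^sub>M i\<in>I. lborel)) =
      indicator {-r..r} s * (\<integral>\<^sup>+ c. (\<Prod>i\<in>I. indicator {-r..r} (c i)) *
        indicator {-\<eta><..<\<eta>} (t + w j * s + (\<Sum>i\<in>I. w i * c i)) \<partial>(\<Pi>\<^sub>M i\<in>I. lborel))"
      unfolding nn_integral_cmult[OF 2, symmetric]
      using assms by (intro nn_integral_cong) (simp add: eq mult.assoc add.assoc del: fun_upd_apply, simp)
  qed
qed

lemma borel_measurable_slab [measurable]:
  assumes "finite I"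
  shows "slab r \<eta> I w \<in> borel_measurable borel"
  using assms
proof induction
  case empty
  then show ?case by (simp add: slab_empty[abs_def])
next
  case (insert j I)
  note [measurable] = insert.IH
  show ?case unfolding slab_insert[OF insert.hyps, abs_def] by measurable
qed

text \<open>As a function of the offset, the slab volume starts as the indicator of a symmetric
  interval and is convolved once per coordinate, which keeps it even and unimodal.\<close>

lemma slab_antimono_abs:
  assumes "finite I" "\<bar>t\<bar> \<le> \<bar>t'\<bar>"
  shows "slab r \<eta> I w t' \<le> slab r \<eta> I w t"
  using assms
proof (induction arbitrary: t t')
  case empty
  then show ?case by (auto simp: slab_empty indicator_def)
next
  case (insert j I)
  show ?case unfolding slab_insert[OF insert.hyps]
    using insert by (intro unimodal_convolution_le) auto
qed

lemma slab_cong: "(\<And>i. i \<in> I \<Longrightarrow> w i = w' i) \<Longrightarrow> slab r \<eta> I w t = slab r \<eta> I w' t"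
  unfolding slab_def by (intro nn_integral_cong) (simp cong: sum.cong)

text \<open>If coordinate \<open>j\<close> is integrated last, the weight \<open>w j\<close> enters
  only through the offset \<open>w j * s\<close> of the remaining slab. With initial offset 0, the
  size of this offset grows with that of \<open>w j\<close> for every \<open>s\<close>, so the
  integrand decreases pointwise.\<close>

lemma slab_0_antimono:
  assumes "finite I" "\<And>i. i \<in> I \<Longrightarrow> \<bar>w i\<bar> \<le> \<bar>w' i\<bar>"
  shows "slab r \<eta> I w' 0 \<le> slab r \<eta> I w 0"
proof -
  \<comment> \<open>The weights are exchanged one at a time; \<open>J\<close> collects the indices
    already switched to \<open>w'\<close>.\<close>
  have "slab r \<eta> I (\<lambda>i. if i \<in> J then w' i else w i) 0 \<le> slab r \<eta> I w 0" if "J \<subseteq> I" for J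
    using finite_subset[OF that assms(1)] that
  proof (induction)
    case (insert j J)
    define K where "K = I - {j}"
    have K: "finite K" "j \<notin> K" "I = insert j K" using assms insert by (auto simp: K_def)
    let ?u = "\<lambda>i. if i \<in> insert j J then w' i else w i" and ?v = "\<lambda>i. if i \<in> J then w' i else w i"
    have "slab r \<eta> I ?u 0 = (\<integral>\<^sup>+ s. indicator {-r..r} s * slab r \<eta> K ?u (?u j * s) \<partial>lborel)"
      unfolding K(3) slab_insert[OF K(1,2)] by simp
    also have "\<dots> \<le> (\<integral>\<^sup>+ s. indicator {-r..r} s * slab r \<eta> K ?u (?v j * s) \<partial>lborel)"
      using assms insert
      by (intro nn_integral_mono mult_left_mono slab_antimono_abs[OF K(1)])
         (auto simp: abs_mult intro!: mult_right_mono)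
    also have "\<dots> = (\<integral>\<^sup>+ s. indicator {-r..r} s * slab r \<eta> K ?v (?v j * s) \<partial>lborel)"
      using K by (intro nn_integral_cong arg_cong2[of _ _ _ _ "(*)"] refl slab_cong) auto
    also have "\<dots> = slab r \<eta> I ?v 0"
      unfolding K(3) slab_insert[OF K(1,2)] by simp
    finally show ?case using insert by auto
  qed simp
  from this[of I] show ?thesis by (simp cong: slab_cong)
qed

text \<open>With equal weights only the number of coordinates counts. This carries estimates from
  the basis of \<open>real^'k\<close>, where \<open>Delta\<close> lives, to the basis of the product
  space of the transference.\<close>

lemma slab_const_card:
  assumes "finite I" "finite J" "card I = card J"
  shows "slab r \<eta> I (\<lambda>_. 1) t = slab r \<eta> J (\<lambda>_. 1) t"
  using assms
proof (induction arbitrary: J t)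
  case (insert i I)
  then obtain j K where K: "J = insert j K" "j \<notin> K" "card I = card K"
    by (metis card_Suc_eq card_insert_disjoint)
  moreover from this have "finite K" using insert by auto
  ultimately show ?case using insert by (simp add: slab_insert)
qed (auto simp: slab_empty)

lemma emeasure_lborel_slab:
  fixes w :: "'a::euclidean_space"
  shows "emeasure lborel {c. (\<forall>b\<in>Basis. \<bar>c \<bullet> b\<bar> \<le> r) \<and> \<bar>c \<bullet> w\<bar> < \<eta>} = slab r \<eta> Basis (\<lambda>b. w \<bullet> b) 0"
proof -
  let ?S = "{c::'a. (\<forall>b\<in>Basis. \<bar>c \<bullet> b\<bar> \<le> r) \<and> \<bar>c \<bullet> w\<bar> < \<eta>}"
  have [measurable]: "?S \<in> sets borel" by measurable
  have "emeasure lborel ?S = (\<integral>\<^sup>+ c. indicator ?S c \<partial>lborel)" by simp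
  also have "\<dots> = (\<integral>\<^sup>+ f. indicator ?S (\<Sum>b\<in>Basis. f b *\<^sub>R b) \<partial>(\<Pi>\<^sub>M b\<in>Basis. lborel))"
    by (subst lborel_eq, subst nn_integral_distr) auto
  also have "\<dots> = slab r \<eta> Basis (\<lambda>b. w \<bullet> b) 0"
    unfolding slab_def
  proof (intro nn_integral_cong)
    fix f :: "'a \<Rightarrow> real"
    have 1: "(\<Prod>i\<in>Basis. indicator {-r..r} (f i) :: ennreal) = indicator {f. \<forall>i\<in>Basis. \<bar>f i\<bar> \<le> r} f"
      by (auto simp: indicator_def abs_le_iff minus_le_iff prod_zero_iff intro!: prod.neutral)
    have 2: "(\<Sum>b\<in>Basis. f b *\<^sub>R b) \<bullet> w = (\<Sum>b\<in>Basis. (w \<bullet> b) * f b)"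
      by (simp add: inner_sum_left mult.commute inner_commute[of w])
    show "indicator ?S (\<Sum>b\<in>Basis. f b *\<^sub>R b) = (\<Prod>i\<in>Basis. indicator {-r..r} (f i)) *
       (indicator {-\<eta><..<\<eta>} (0 + (\<Sum>b\<in>Basis. (w \<bullet> b) * f b)) :: ennreal)"
      unfolding 1 by (auto simp: indicator_def 2 abs_less_iff)
  qed
  finally show ?thesis .
qed

subsection \<open>Sections by hyperplanes and orthonormal coordinates\<close>

text \<open>The library's \<open>measure_orthogonal_image\<close> requires a well-ordered index type. Here uniqueness
  of Haar measure is replayed: the double integral of \<open>indicator A (T x) * indicator B (y - T x)\<close>
  over \<open>x\<close> and \<open>y\<close>, for \<open>B\<close> the unit ball, is evaluated in both orders.\<close>
lemma lborel_distr_orthogonal: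
  fixes T :: "'a::euclidean_space \<Rightarrow> 'a"
  assumes T: "orthogonal_transformation T"
  shows "distr lborel borel T = lborel"
proof (rule measure_eqI)
  have lin: "linear T" using T by (rule orthogonal_transformation_linear)
  have [measurable]: "T \<in> borel_measurable borel"
    using lin by (intro borel_measurable_continuous_onI linear_continuous_on linear_linear[THEN iffD2])
  fix A assume "A \<in> sets (distr lborel borel T)"
  hence A [measurable]: "A \<in> sets borel" by simp
  have [measurable]: "T -` A \<in> sets borel"
    using measurable_sets[of T borel borel A] by simp
  define B where "B = cball (0::'a) 1"
  have [measurable]: "B \<in> sets borel" by (simp add: B_def)
  have inv: "(\<integral>\<^sup>+ y. f (a + y) \<partial>lborel) = (\<integral>\<^sup>+ y. f y \<partial>lborel)"
    if [measurable]: "f \<in> borel_measurable borel" for f :: "'a \<Rightarrow> ennreal" and a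
    using nn_integral_distr[of "\<lambda>y. a + y" lborel borel f] lborel_distr_plus[of a] by simp
  have B_T: "indicator B (T x) = (indicator B x :: ennreal)" for x
    using orthogonal_transformation_norm[OF T] by (simp add: B_def indicator_def)
  have invA: "(\<integral>\<^sup>+ y. indicator A (a + y) \<partial>lborel) = emeasure lborel A"
    and invB: "(\<integral>\<^sup>+ y. indicator B (y - a) \<partial>lborel) = emeasure lborel B" for a
    using inv[of "indicator A" a] inv[of "indicator B" "- a"] by simp_all
  have "emeasure lborel B * emeasure (distr lborel borel T) A
      = (\<integral>\<^sup>+ x. indicator A (T x) * emeasure lborel B \<partial>lborel)"
    by (subst nn_integral_multc) (simp_all add: emeasure_distr mult.commute flip: indicator_vimage)
  also have "\<dots> = (\<integral>\<^sup>+ x. (\<integral>\<^sup>+ y. indicator A (T x) * indicator B (- T x + y) \<partial>lborel) \<partial>lborel)"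
    by (intro nn_integral_cong) (simp add: nn_integral_cmult invB)
  also have "\<dots> = (\<integral>\<^sup>+ y. (\<integral>\<^sup>+ x. indicator A (T x) * indicator B (- T x + y) \<partial>lborel) \<partial>lborel)"
    by (intro lborel_pair.Fubini') simp
  also have "\<dots> = (\<integral>\<^sup>+ y. (\<integral>\<^sup>+ x. indicator A (T x + y) * indicator B (T x) \<partial>lborel) \<partial>lborel)"
  proof (rule nn_integral_cong)
    fix y
    obtain z where z: "y = T z" using orthogonal_transformation_surj[OF T] by (metis surjD)
    \<comment> \<open>Translating \<open>x\<close> by a preimage \<open>z\<close> of
      \<open>y\<close> moves \<open>y\<close> from the factor of \<open>B\<close> to the factor of
      \<open>A\<close>. The sign left in the argument of \<open>B\<close> disappears because the
      ball is symmetric.\<close>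
    have "(\<integral>\<^sup>+ x. indicator A (T x) * indicator B (- T x + y) \<partial>lborel)
        = (\<integral>\<^sup>+ x. indicator A (T (z + x)) * indicator B (- T (z + x) + y) \<partial>lborel)"
      by (rule inv[symmetric]) simp
    also have "\<dots> = (\<integral>\<^sup>+ x. indicator A (T x + y) * indicator B (T x) \<partial>lborel)"
      by (intro nn_integral_cong) (simp add: z linear_add[OF lin] B_def indicator_def add.commute)
    finally show "(\<integral>\<^sup>+ x. indicator A (T x) * indicator B (- T x + y) \<partial>lborel) =
      (\<integral>\<^sup>+ x. indicator A (T x + y) * indicator B (T x) \<partial>lborel)" .
  qed
  also have "\<dots> = (\<integral>\<^sup>+ x. (\<integral>\<^sup>+ y. indicator A (T x + y) * indicator B (T x) \<partial>lborel) \<partial>lborel)"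
    by (intro lborel_pair.Fubini') simp
  also have "\<dots> = (\<integral>\<^sup>+ x. emeasure lborel A * indicator B x \<partial>lborel)"
    by (intro nn_integral_cong) (simp add: nn_integral_multc invA B_T)
  also have "\<dots> = emeasure lborel B * emeasure lborel A"
    by (subst nn_integral_cmult) (simp_all add: mult.commute)
  finally have *: "emeasure lborel B * emeasure (distr lborel borel T) A = emeasure lborel B * emeasure lborel A" .
  have "emeasure lborel B > 0" "emeasure lborel B < \<infinity>"
    unfolding B_def using emeasure_lborel_cball_finite[of "0::'a" 1] by (auto simp: emeasure_cball)
  hence "emeasure lborel B \<noteq> 0" "emeasure lborel B \<noteq> \<infinity>" by auto
  with * show "emeasure (distr lborel borel T) A = emeasure lborel A"
    by (auto simp: ennreal_mult_cancel_left)
qed simp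

text \<open>A bijection \<open>\<pi>\<close> from the standard basis to \<open>B\<close> extends to
  an orthogonal map \<open>T\<close>, which preserves \<open>lborel\<close>. Coordinates of
  \<open>T x\<close> along \<open>B\<close> are the standard coordinates of \<open>x\<close> renamed
  by \<open>\<pi>\<close>, so box volumes agree.\<close>

lemma lborel_eq_orthonormal:
  fixes B :: "'a::euclidean_space set"
  assumes B: "orthonormal_basis_of UNIV B"
  shows "lborel = distr (\<Pi>\<^sub>M b\<in>B. lborel) borel (\<lambda>f. \<Sum>b\<in>B. f b *\<^sub>R b)"
proof -
  have orth: "pairwise orthogonal B" and norm: "\<And>b. b \<in> B \<Longrightarrow> norm b = 1" and span: "span B = UNIV"
    using B by (auto simp: orthonormal_basis_of_def)
  have "0 \<notin> B" using norm by force
  hence ind: "independent B" using orth by (simp add: pairwise_orthogonal_independent)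
  have [simp]: "finite B" using ind by (rule independent_imp_finite)
  have ip: "b \<bullet> c = (if b = c then 1 else 0)" if "b \<in> B" "c \<in> B" for b c
    using orth norm that by (auto simp: pairwise_def orthogonal_def norm_eq_1)
  have "card B = DIM('a)"
    using ind span by (metis dim_UNIV dim_eq_card dim_span)
  then obtain \<pi> where \<pi>: "bij_betw \<pi> (Basis :: 'a set) B"
    using bij_betw_iff_card[of Basis B] by auto
  define T where "T = (\<lambda>x::'a. \<Sum>b\<in>Basis. (x \<bullet> b) *\<^sub>R \<pi> b)"
  have \<pi>B: "\<pi> b \<in> B" if "b \<in> Basis" for b using \<pi> that by (auto simp: bij_betw_def)
  have Tb: "T x \<bullet> \<pi> b = x \<bullet> b" if "b \<in> Basis" for x b
  proof -
    have "T x \<bullet> \<pi> b = (\<Sum>c\<in>Basis. if c = b then x \<bullet> c else 0)"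
      unfolding T_def inner_sum_left using that \<pi> \<pi>B
      by (intro sum.cong) (auto simp: ip bij_betw_def inj_on_eq_iff)
    thus ?thesis using that by simp
  qed
  have T: "orthogonal_transformation T"
    unfolding orthogonal_transformation_def
  proof (intro conjI allI)
    show "linear T"
      by (rule linearI) (auto simp: T_def inner_add_left scaleR_left_distrib sum.distrib scaleR_sum_right)
    show "T v \<bullet> T w = v \<bullet> w" for v w
    proof -
      have "T v \<bullet> T w = (\<Sum>b\<in>Basis. (w \<bullet> b) * (T v \<bullet> \<pi> b))"
      proof -
        have "T v \<bullet> T w = T v \<bullet> (\<Sum>b\<in>Basis. (w \<bullet> b) *\<^sub>R \<pi> b)" by (simp only: T_def)
        thus ?thesis by (simp add: inner_sum_right)
      qed
      also have "\<dots> = (\<Sum>b\<in>Basis. (v \<bullet> b) * (w \<bullet> b))" by (intro sum.cong) (simp_all add: Tb)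
      also have "\<dots> = v \<bullet> w" by (rule euclidean_inner[symmetric])
      finally show ?thesis .
    qed
  qed
  have rep: "(\<Sum>b\<in>B. (x \<bullet> b) *\<^sub>R b) = x" for x
  proof -
    obtain y where y: "x = T y" using orthogonal_transformation_surj[OF T] by (metis surjD)
    have "(\<Sum>b\<in>B. (x \<bullet> b) *\<^sub>R b) = (\<Sum>b\<in>Basis. (x \<bullet> \<pi> b) *\<^sub>R \<pi> b)"
      by (rule sum.reindex_bij_betw[OF \<pi>, symmetric])
    also have "\<dots> = (\<Sum>b\<in>Basis. (y \<bullet> b) *\<^sub>R \<pi> b)"
      unfolding y by (intro sum.cong) (auto simp: Tb)
    finally show ?thesis by (simp add: y T_def)
  qed
  interpret P: product_sigma_finite "\<lambda>_::'a. lborel :: real measure" ..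
  interpret P': finite_product_sigma_finite "\<lambda>_::'a. lborel :: real measure" Basis by standard simp
  have [measurable]: "T \<in> borel_measurable borel"
    unfolding T_def by measurable
  define C where "C = (\<lambda>x. \<lambda>b\<in>B. x \<bullet> b)"
  have C [measurable]: "C \<in> borel \<rightarrow>\<^sub>M (\<Pi>\<^sub>M b\<in>B. lborel)"
    unfolding C_def by (intro measurable_restrict) simp
  have "distr lborel (\<Pi>\<^sub>M b\<in>B. lborel) C = (\<Pi>\<^sub>M b\<in>B. lborel)"
  proof (rule P.PiM_eqI)
    fix A :: "'a \<Rightarrow> real set"
    assume A: "\<And>b. b \<in> B \<Longrightarrow> A b \<in> sets lborel"
    have [measurable]: "Pi\<^sub>E B A \<in> sets (\<Pi>\<^sub>M b\<in>B. lborel)"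
      using A by (intro sets_PiM_I_finite) auto
    have A': "A (\<pi> b) \<in> sets borel" if "b \<in> Basis" for b using A[OF \<pi>B[OF that]] by simp
    have "emeasure (distr lborel (\<Pi>\<^sub>M b\<in>B. lborel) C) (Pi\<^sub>E B A) = emeasure lborel (C -` Pi\<^sub>E B A)"
      by (simp add: emeasure_distr)
    also have "\<dots> = emeasure (distr lborel borel T) (C -` Pi\<^sub>E B A)"
      by (simp add: lborel_distr_orthogonal[OF T])
    also have "\<dots> = emeasure lborel (T -` C -` Pi\<^sub>E B A)"
      using measurable_sets[OF C, of "Pi\<^sub>E B A"] by (simp add: emeasure_distr)
    also have "T -` C -` Pi\<^sub>E B A = {x. \<forall>b\<in>Basis. x \<bullet> b \<in> A (\<pi> b)}"
    proof -
      have "C (T x) \<in> Pi\<^sub>E B A \<longleftrightarrow> (\<forall>b\<in>Basis. x \<bullet> b \<in> A (\<pi> b))" for x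
      proof -
        have "C (T x) \<in> Pi\<^sub>E B A \<longleftrightarrow> (\<forall>b\<in>\<pi> ` Basis. T x \<bullet> b \<in> A b)"
          using \<pi> by (auto simp: C_def PiE_iff bij_betw_def)
        thus ?thesis by (simp add: Tb)
      qed
      thus ?thesis by auto
    qed
    also have "emeasure lborel \<dots> = (\<integral>\<^sup>+ x. (\<Prod>b\<in>Basis. indicator (A (\<pi> b)) (x \<bullet> b)) \<partial>lborel)"
    proof -
      have [measurable]: "{x::'a. \<forall>b\<in>Basis. x \<bullet> b \<in> A (\<pi> b)} \<in> sets borel"
        using A' by measurable
      have *: "indicator {x. \<forall>b\<in>Basis. x \<bullet> b \<in> A (\<pi> b)} x = (\<Prod>b\<in>Basis. indicator (A (\<pi> b)) (x \<bullet> b) :: ennreal)"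
        for x :: 'a
        by (auto simp: indicator_def prod_zero_iff intro!: prod.neutral[symmetric])
      show ?thesis unfolding *[symmetric] by simp
    qed
    also have "\<dots> = (\<Prod>b\<in>Basis. emeasure lborel (A (\<pi> b)))"
      using A' by (subst nn_integral_lborel_prod) auto
    also have "\<dots> = (\<Prod>b\<in>B. emeasure lborel (A b))"
      by (rule prod.reindex_bij_betw[OF \<pi>])
    finally show "emeasure (distr lborel (\<Pi>\<^sub>M b\<in>B. lborel) C) (Pi\<^sub>E B A) =
      (\<Prod>b\<in>B. emeasure lborel (A b))" .
  qed simp_all
  hence "distr (\<Pi>\<^sub>M b\<in>B. lborel) borel (\<lambda>f. \<Sum>b\<in>B. f b *\<^sub>R b)
     = distr (distr lborel (\<Pi>\<^sub>M b\<in>B. lborel) C) borel (\<lambda>f. \<Sum>b\<in>B. f b *\<^sub>R b)" by simp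
  also have "\<dots> = distr lborel borel (\<lambda>x. x)"
    by (subst distr_distr) (auto simp: o_def C_def rep cong: sum.cong)
  finally show ?thesis by (simp add: distr_id2)
qed

text \<open>Adding the unit normal to an orthonormal basis of the hyperplane gives one of the whole
  space, and Fubini splits off the normal coordinate. This is how \<open>subspace_lborel\<close> is
  related to ordinary volume.\<close>

lemma emeasure_hyperplane_prism:
  fixes \<nu> :: "'a::euclidean_space"
  assumes \<nu>: "norm \<nu> = 1" and S [measurable]: "S \<in> sets borel" and \<tau>: "\<tau> > 0"
  shows "emeasure lborel {c. \<bar>c \<bullet> \<nu>\<bar> < \<tau> \<and> c - (c \<bullet> \<nu>) *\<^sub>R \<nu> \<in> S} =
    ennreal (2 * \<tau>) * emeasure (subspace_lborel {x. x \<bullet> \<nu> = 0}) S"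
proof -
  let ?H = "{x. x \<bullet> \<nu> = 0}"
  \<comment> \<open>This has to be the very basis chosen inside \<open>subspace_lborel\<close>, so
    that unfolding the definition later meets the same product measure.\<close>
  define B where "B = (SOME B. orthonormal_basis_of ?H B)"
  have "subspace ?H" by (simp add: subspace_def inner_add_left)
  then obtain B0 where "orthonormal_basis_of ?H B0"
    using orthonormal_basis_subspace[of ?H] unfolding orthonormal_basis_of_def by metis
  hence "orthonormal_basis_of ?H B" unfolding B_def by (rule someI)
  hence orth: "pairwise orthogonal B" and norm: "\<And>b. b \<in> B \<Longrightarrow> norm b = 1" and span: "span B = ?H"
    by (auto simp: orthonormal_basis_of_def)
  have B\<nu>: "b \<bullet> \<nu> = 0" if "b \<in> B" for b using span span_base[OF that] by auto
  have \<nu>\<nu>: "\<nu> \<bullet> \<nu> = 1" using \<nu> by (simp add: norm_eq_1)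
  have "\<nu> \<notin> B" using B\<nu>[of \<nu>] \<nu>\<nu> by auto
  have "0 \<notin> B" using norm by force
  hence [simp]: "finite B" using orth
    by (intro independent_imp_finite pairwise_orthogonal_independent) auto
  have "x \<in> span (insert \<nu> B)" for x
  proof -
    have "x - (x \<bullet> \<nu>) *\<^sub>R \<nu> \<in> ?H" by (simp add: inner_diff_left \<nu>\<nu>)
    hence "x - (x \<bullet> \<nu>) *\<^sub>R \<nu> \<in> span B" using span by simp
    thus ?thesis by (auto simp: span_insert)
  qed
  hence B': "orthonormal_basis_of UNIV (insert \<nu> B)"
    using orth norm \<nu> B\<nu> by (auto simp: orthonormal_basis_of_def pairwise_insert orthogonal_def inner_commute)
  interpret product_sigma_finite "\<lambda>_::'a. lborel :: real measure" ..
  let ?P = "{c. \<bar>c \<bullet> \<nu>\<bar> < \<tau> \<and> c - (c \<bullet> \<nu>) *\<^sub>R \<nu> \<in> S}"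
  have [measurable]: "?P \<in> sets borel" by measurable
  have ind: "indicator ?P (\<Sum>b\<in>insert \<nu> B. (f(\<nu> := t)) b *\<^sub>R b) =
      indicator {-\<tau><..<\<tau>} t * (indicator S (\<Sum>b\<in>B. f b *\<^sub>R b) :: ennreal)" for f t
  proof -
    have "(\<Sum>b\<in>B. (f(\<nu> := t)) b *\<^sub>R b) = (\<Sum>b\<in>B. f b *\<^sub>R b)"
      using \<open>\<nu> \<notin> B\<close> by (intro sum.cong) auto
    hence 1: "(\<Sum>b\<in>insert \<nu> B. (f(\<nu> := t)) b *\<^sub>R b) = t *\<^sub>R \<nu> + (\<Sum>b\<in>B. f b *\<^sub>R b)"
      using \<open>\<nu> \<notin> B\<close> by simp
    have 2: "(t *\<^sub>R \<nu> + (\<Sum>b\<in>B. f b *\<^sub>R b)) \<bullet> \<nu> = t"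
      by (simp add: inner_add_left inner_sum_left B\<nu> \<nu>\<nu>)
    show ?thesis unfolding 1 by (auto simp: indicator_def 2)
  qed
  have "emeasure lborel ?P = (\<integral>\<^sup>+ f. indicator ?P (\<Sum>b\<in>insert \<nu> B. f b *\<^sub>R b) \<partial>(\<Pi>\<^sub>M b\<in>insert \<nu> B. lborel))"
    by (subst lborel_eq_orthonormal[OF B'], subst nn_integral_indicator[symmetric], simp,
        subst nn_integral_distr) auto
  also have "\<dots> = (\<integral>\<^sup>+ t. \<integral>\<^sup>+ f. indicator {-\<tau><..<\<tau>} t * indicator S (\<Sum>b\<in>B. f b *\<^sub>R b) \<partial>(\<Pi>\<^sub>M b\<in>B. lborel) \<partial>lborel)"
    using \<open>\<nu> \<notin> B\<close> by (subst product_nn_integral_insert_rev) (simp_all only: ind, auto)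
  also have "\<dots> = (\<integral>\<^sup>+ t. indicator {-\<tau><..<\<tau>} t * emeasure (subspace_lborel ?H) S \<partial>lborel)"
  proof (intro nn_integral_cong)
    fix t :: real
    have "(\<integral>\<^sup>+ f. indicator S (\<Sum>b\<in>B. f b *\<^sub>R b) \<partial>(\<Pi>\<^sub>M b\<in>B. lborel)) = emeasure (subspace_lborel ?H) S"
      unfolding subspace_lborel_def B_def[symmetric] Let_def
      by (subst nn_integral_indicator[symmetric], simp, subst nn_integral_distr) auto
    thus "(\<integral>\<^sup>+ f. indicator {-\<tau><..<\<tau>} t * indicator S (\<Sum>b\<in>B. f b *\<^sub>R b) \<partial>(\<Pi>\<^sub>M b\<in>B. lborel)) =
      indicator {-\<tau><..<\<tau>} t * emeasure (subspace_lborel ?H) S"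
      by (subst nn_integral_cmult) auto
  qed
  also have "\<dots> = ennreal (2 * \<tau>) * emeasure (subspace_lborel ?H) S"
    using \<tau> by (simp add: nn_integral_multc)
  finally show ?thesis .
qed

subsection \<open>Lattice points\<close>

text \<open>Coordinates are taken along \<open>Basis\<close> so that one notion of lattice serves
  both vectors and pairs of vectors.\<close>

definition int_points :: "'a::euclidean_space set" where
  "int_points = {z. \<forall>b\<in>Basis. z \<bullet> b \<in> \<int>}"

lemma subset_coordinate_image:
  "{z::'a::euclidean_space. \<forall>b\<in>Basis. z \<bullet> b \<in> F} \<subseteq> (\<lambda>f. \<Sum>b\<in>Basis. f b *\<^sub>R b) ` (Basis \<rightarrow>\<^sub>E F)"
proof
  fix z :: 'a assume "z \<in> {z. \<forall>b\<in>Basis. z \<bullet> b \<in> F}"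
  thus "z \<in> (\<lambda>f. \<Sum>b\<in>Basis. f b *\<^sub>R b) ` (Basis \<rightarrow>\<^sub>E F)"
    by (intro image_eqI[of _ _ "\<lambda>b\<in>Basis. z \<bullet> b"]) (auto simp: euclidean_representation)
qed

lemma countable_int_points: "countable (int_points :: 'a::euclidean_space set)"
proof -
  have "countable (\<int> :: real set)" by (simp add: Ints_def)
  hence "countable (Basis \<rightarrow>\<^sub>E \<int> :: ('a \<Rightarrow> real) set)" by (intro countable_PiE) auto
  thus ?thesis unfolding int_points_def
    by (intro countable_subset[OF subset_coordinate_image]) auto
qed

lemma finite_int_points_bounded:
  "finite {z \<in> (int_points :: 'a::euclidean_space set). \<forall>b\<in>Basis. \<bar>z \<bullet> b\<bar> \<le> M}"
proof -
  have "finite (Basis \<rightarrow>\<^sub>E {k \<in> \<int>. \<bar>k\<bar> \<le> M} :: ('a \<Rightarrow> real) set)"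
    by (intro finite_PiE finite_abs_int_segment) auto
  hence "finite {z::'a. \<forall>b\<in>Basis. z \<bullet> b \<in> {k \<in> \<int>. \<bar>k\<bar> \<le> M}}"
    by (intro finite_subset[OF subset_coordinate_image]) auto
  moreover have "{z::'a. \<forall>b\<in>Basis. z \<bullet> b \<in> {k \<in> \<int>. \<bar>k\<bar> \<le> M}} = {z \<in> int_points. \<forall>b\<in>Basis. \<bar>z \<bullet> b\<bar> \<le> M}"
    by (auto simp: int_points_def)
  ultimately show ?thesis by simp
qed

lemma int_points_diff: "z \<in> int_points \<Longrightarrow> z' \<in> int_points \<Longrightarrow> z - z' \<in> int_points"
  by (auto simp: int_points_def inner_diff_left)

lemma int_points_inner: "z \<in> int_points \<Longrightarrow> z' \<in> int_points \<Longrightarrow> z \<bullet> z' \<in> \<int>"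
  by (subst euclidean_inner) (auto simp: int_points_def)

text \<open>Cut the set along the half-open unit cubes at lattice points and move all pieces into
  one cube. Without a collision the moved pieces are disjoint there, so the total volume is at most
  1.\<close>

lemma blichfeldt:
  fixes S :: "'a::euclidean_space set"
  assumes [measurable]: "S \<in> sets borel" and gt: "emeasure lborel S > 1"
  shows "\<exists>p\<in>S. \<exists>q\<in>S. p \<noteq> q \<and> p - q \<in> int_points"
proof (rule ccontr)
  assume no: "\<not> ?thesis"
  define U where "U = {x::'a. \<forall>b\<in>Basis. 0 \<le> x \<bullet> b \<and> x \<bullet> b < 1}"
  have [measurable]: "U \<in> sets borel" unfolding U_def by measurable
  \<comment> \<open>\<open>Y z\<close> is the piece of \<open>S\<close> in the unit cube at
    \<open>z\<close>, and \<open>X z\<close> is the same piece moved back to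
    \<open>U\<close>.\<close>
  define X where "X = (\<lambda>z. {x. z + x \<in> S \<and> x \<in> U})"
  define Y where "Y = (\<lambda>z. {x. x \<in> S \<and> x - z \<in> U})"
  have [measurable]: "X z \<in> sets borel" "Y z \<in> sets borel" for z
    unfolding X_def Y_def by measurable
  have disjX: "disjoint_family_on X int_points"
    unfolding disjoint_family_on_def
  proof safe
    fix z z' x assume *: "z \<in> int_points" "z' \<in> int_points" "z \<noteq> z'" "x \<in> X z" "x \<in> X z'"
    hence "z + x \<in> S" "z' + x \<in> S" "z + x \<noteq> z' + x" "(z + x) - (z' + x) \<in> int_points"
      by (auto simp: X_def int_points_diff)
    with no show "x \<in> {}" by blast
  qed
  have floor: "z \<bullet> b = of_int \<lfloor>x \<bullet> b\<rfloor>" if "z \<in> int_points" "x \<in> Y z" "b \<in> Basis" for x z b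
  proof -
    from that obtain k where k: "z \<bullet> b = of_int k" by (auto simp: int_points_def elim: Ints_cases)
    have "0 \<le> x \<bullet> b - z \<bullet> b" "x \<bullet> b - z \<bullet> b < 1"
      using that by (auto simp: Y_def U_def inner_diff_left)
    hence "\<lfloor>x \<bullet> b\<rfloor> = k" using k by (intro floor_unique) auto
    thus ?thesis using k by simp
  qed
  have disjY: "disjoint_family_on Y int_points"
    unfolding disjoint_family_on_def
  proof safe
    fix z z' x assume *: "z \<in> int_points" "z' \<in> int_points" "z \<noteq> z'" "x \<in> Y z" "x \<in> Y z'"
    have "z = z'" by (rule euclidean_eqI) (metis floor *(1,2,4,5))
    with * show "x \<in> {}" by blast
  qed
  have "S = (\<Union>z\<in>int_points. Y z)"
  proof safe
    fix x assume "x \<in> S"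
    let ?z = "\<Sum>b\<in>Basis. of_int \<lfloor>x \<bullet> b\<rfloor> *\<^sub>R b"
    have z: "?z \<bullet> b = of_int \<lfloor>x \<bullet> b\<rfloor>" if "b \<in> Basis" for b using that by simp
    have "?z \<in> int_points" by (simp add: int_points_def)
    moreover have "x - ?z \<in> U"
      unfolding U_def inner_diff_left mem_Collect_eq
    proof
      fix b :: 'a assume "b \<in> Basis"
      thus "0 \<le> x \<bullet> b - ?z \<bullet> b \<and> x \<bullet> b - ?z \<bullet> b < 1" unfolding z[OF \<open>b \<in> Basis\<close>] by linarith
    qed
    ultimately
    show "x \<in> (\<Union>z\<in>int_points. Y z)"
      using \<open>x \<in> S\<close> by (intro UN_I[of ?z]) (simp_all add: Y_def)
  qed (auto simp: Y_def)
  hence "emeasure lborel S = emeasure lborel (\<Union>z\<in>int_points. Y z)" by simp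
  also have "\<dots> = (\<integral>\<^sup>+ z. emeasure lborel (Y z) \<partial>count_space int_points)"
    by (intro emeasure_UN_countable disjY countable_int_points) auto
  also have "\<dots> = (\<integral>\<^sup>+ z. emeasure lborel (X z) \<partial>count_space int_points)"
  proof (intro nn_integral_cong)
    fix z :: 'a
    have "emeasure lborel (Y z) = emeasure (distr lborel borel ((+) z)) (Y z)"
      by (simp add: lborel_distr_plus)
    also have "\<dots> = emeasure lborel (X z)"
      by (subst emeasure_distr) (auto simp: X_def Y_def intro!: arg_cong[of _ _ "emeasure lborel"])
    finally show "emeasure lborel (Y z) = emeasure lborel (X z)" .
  qed
  also have "\<dots> = emeasure lborel (\<Union>z\<in>int_points. X z)"
    by (intro emeasure_UN_countable[symmetric] disjX countable_int_points) auto
  also have "\<dots> \<le> emeasure lborel (cbox 0 One :: 'a set)"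
    by (intro emeasure_mono) (auto simp: X_def U_def mem_box less_imp_le)
  also have "\<dots> = 1" by (simp add: emeasure_lborel_cbox_eq)
  finally show False using gt by simp
qed

text \<open>The translates of \<open>A\<close> by \<open>(i / N) u\<close> for \<open>i < N\<close> are disjoint of total measure greater than 1.
  A lattice vector joining two points of their union has inner product with \<open>v\<close> below \<open>g\<close> in
  absolute value, hence 0, so both points lie in the same translate.\<close>
lemma blichfeldt_slab:
  fixes A :: "'a::euclidean_space set"
  assumes A [measurable]: "A \<in> sets borel" and gt: "emeasure lborel A > ennreal (1 / real N)"
    and N: "N > 0" and g: "g > 0"
    and u: "u \<bullet> v = g" and min: "\<And>z. z \<in> int_points \<Longrightarrow> \<bar>z \<bullet> v\<bar> < g \<Longrightarrow> z \<bullet> v = 0"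
    and slab: "\<And>a. a \<in> A \<Longrightarrow> \<bar>a \<bullet> v\<bar> < g / (2 * real N)"
  shows "\<exists>a\<in>A. \<exists>a'\<in>A. a \<noteq> a' \<and> a - a' \<in> int_points"
proof -
  define w where "w = (\<lambda>i::nat. (real i / real N) *\<^sub>R u)"
  define P where "P = (\<lambda>i. {x. x - w i \<in> A})"
  have [measurable]: "P i \<in> sets borel" for i unfolding P_def by measurable
  have P: "emeasure lborel (P i) = emeasure lborel A" for i
  proof -
    have "emeasure lborel (P i) = emeasure (distr lborel borel ((+) (w i))) (P i)"
      by (simp add: lborel_distr_plus)
    thus ?thesis by (simp add: emeasure_distr P_def)
  qed
  have wv: "w i \<bullet> v = real i * (g / real N)" for i by (simp add: w_def u)
  have eq: "i = j" if "x \<in> P i" "y \<in> P j" "i < N" "j < N" "x - y \<in> int_points" for x y i j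
  proof -
    have "\<bar>(x - w i) \<bullet> v\<bar> < g / (2 * real N)" "\<bar>(y - w j) \<bullet> v\<bar> < g / (2 * real N)"
      using that slab by (auto simp: P_def)
    hence 1: "\<bar>(x - y) \<bullet> v - (real i - real j) * (g / real N)\<bar> < g / real N"
      by (simp add: inner_diff_left wv algebra_simps)
    \<comment> \<open>Two indices below \<open>N\<close> differ by at most \<open>N - 1\<close>. The
      step \<open>g / N\<close> thus left over absorbs the two half-widths and keeps the inner
      product strictly below \<open>g\<close>.\<close>
    have "\<bar>real i - real j\<bar> * (g / real N) \<le> (real N - 1) * (g / real N)"
      using that g by (intro mult_right_mono) (auto simp: abs_le_iff)
    also have "\<dots> = g - g / real N" using N by (simp add: field_simps)
    finally have 2: "\<bar>(real i - real j) * (g / real N)\<bar> \<le> g - g / real N"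
      using g by (simp add: abs_mult)
    define e where "e = (real i - real j) * (g / real N)"
    have "\<bar>(x - y) \<bullet> v\<bar> < g" using 1 2 unfolding e_def[symmetric] by linarith
    hence "(x - y) \<bullet> v = 0" by (intro min that)
    hence "\<bar>real i - real j\<bar> * (g / real N) < 1 * (g / real N)"
      using 1 g by (simp add: abs_mult)
    hence "\<bar>real i - real j\<bar> < 1" using g N by (subst (asm) mult_less_cancel_right) auto
    thus ?thesis by linarith
  qed
  have 0: "(0::'a) \<in> int_points" by (simp add: int_points_def)
  \<comment> \<open>The translates are disjoint by \<open>eq\<close> for the zero lattice vector,
    that is, for \<open>x = y\<close>.\<close>
  have "emeasure lborel (\<Union>i<N. P i) = (\<Sum>i<N. emeasure lborel (P i))"
    using eq 0 by (intro sum_emeasure[symmetric]) (auto simp: disjoint_family_on_def)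
  also have "\<dots> = of_nat N * emeasure lborel A" by (simp add: P)
  also have "\<dots> > 1"
  proof -
    have "1 = of_nat N * ennreal (1 / real N)"
      using N by (simp add: ennreal_of_nat_eq_real_of_nat flip: ennreal_mult ennreal_1)
    also have "\<dots> < of_nat N * emeasure lborel A"
      using N gt by (intro ennreal_mult_strict_left_mono) (auto simp: of_nat_less_top)
    finally show ?thesis .
  qed
  finally obtain p q i j where "p \<in> P i" "i < N" "q \<in> P j" "j < N" "p \<noteq> q" "p - q \<in> int_points"
    using blichfeldt[of "\<Union>i<N. P i"] by auto
  moreover from this have "i = j" by (intro eq)
  ultimately show ?thesis
    by (intro bexI[of _ "p - w i"] bexI[of _ "q - w i"]) (auto simp: P_def)
qed

text \<open>Inner products of \<open>v\<close> with lattice points are integers, and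
  \<open>v \<bullet> v\<close> is a positive one. So a least positive absolute value exists, and
  \<open>u\<close> is given the sign that makes its product positive.\<close>

lemma minimal_inner_product:
  fixes v :: "'a::euclidean_space"
  assumes v: "v \<in> int_points" "v \<noteq> 0"
  obtains u g where "g \<ge> 1" "u \<bullet> v = g" "\<And>z. z \<in> int_points \<Longrightarrow> \<bar>z \<bullet> v\<bar> < g \<Longrightarrow> z \<bullet> v = 0"
proof -
  define Q where "Q = (\<lambda>k::nat. k > 0 \<and> (\<exists>u\<in>int_points. \<bar>u \<bullet> v\<bar> = real k))"
  have ex: "\<exists>k::nat. \<bar>z \<bullet> v\<bar> = real k" if "z \<in> int_points" for z
    using int_points_inner[OF that v(1)] by (elim Ints_cases) (metis of_int_abs of_nat_nat abs_ge_zero of_int_of_nat_eq)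
  have pos: "v \<bullet> v > 0" using v by simp
  from ex[OF v(1)] obtain k where "\<bar>v \<bullet> v\<bar> = real k" by blast
  hence "Q k" using v pos by (auto simp: Q_def intro!: bexI[of _ v])
  define k where "k = (LEAST k. Q k)"
  have "Q k" unfolding k_def by (rule LeastI) fact
  then obtain u where u: "k > 0" "\<bar>u \<bullet> v\<bar> = real k" by (auto simp: Q_def)
  have "z \<bullet> v = 0" if z: "z \<in> int_points" "\<bar>z \<bullet> v\<bar> < real k" for z
  proof -
    from ex[OF z(1)] obtain l where l: "\<bar>z \<bullet> v\<bar> = real l" by blast
    hence "l < k" using z by simp
    hence "\<not> Q l" unfolding k_def by (rule not_less_Least)
    thus ?thesis using l z by (auto simp: Q_def)
  qed
  moreover have "(sgn (u \<bullet> v) *\<^sub>R u) \<bullet> v = real k" using u by (simp flip: abs_sgn add: mult.commute)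
  ultimately show ?thesis using u by (intro that[of "real k" "sgn (u \<bullet> v) *\<^sub>R u"]) auto
qed

subsection \<open>Volumes of slabs and the constant Delta\<close>

text \<open>The prism of height \<open>2 * \<eta> / sqrt d\<close> over the central section lies in
  the slab of the enlarged cube: moving a point along the diagonal by less than half that height
  changes each coordinate by at most \<open>\<eta>\<close>, which the margin \<open>\<delta>\<close>
  absorbs. Positivity holds because the prism contains a ball.\<close>

lemma subspace_lborel_cube_section:
  fixes \<delta> \<eta> :: real
  defines "d \<equiv> real CARD('k::finite)"
  defines "H \<equiv> {x :: real^'k. (\<Sum>i\<in>UNIV. x $ i) = 0}"
  defines "S \<equiv> {x :: real^'k. (\<forall>i. x $ i \<in> {-1..1}) \<and> (\<Sum>i\<in>UNIV. x $ i) = 0}"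
  assumes \<eta>: "0 < \<eta>" "\<eta> \<le> \<delta>"
  shows "0 < measure (subspace_lborel H) S"
    and "ennreal (2 * \<eta> / sqrt d * measure (subspace_lborel H) S)
           \<le> slab (1 + \<delta>) \<eta> (Basis :: (real^'k) set) (\<lambda>_. 1) 0"
proof -
  have d: "d \<ge> 1" by (simp add: d_def Suc_leI)
  define \<nu> :: "real^'k" where "\<nu> = (\<chi> i. 1 / sqrt d)"
  define w :: "real^'k" where "w = (\<chi> i. 1)"
  define \<tau> where "\<tau> = \<eta> / sqrt d"
  have \<tau>: "\<tau> > 0" using d \<eta> by (simp add: \<tau>_def)
  have c\<nu>: "c \<bullet> \<nu> = (\<Sum>i\<in>UNIV. c $ i) / sqrt d" for c :: "real^'k"
    by (simp add: inner_vec_def \<nu>_def sum_divide_distrib)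
  have cw: "c \<bullet> w = (\<Sum>i\<in>UNIV. c $ i)" for c :: "real^'k"
    by (simp add: inner_vec_def w_def)
  have \<nu>: "norm \<nu> = 1" unfolding norm_eq_1 c\<nu> using d by (simp add: \<nu>_def d_def)
  have H: "H = {x. x \<bullet> \<nu> = 0}" using d by (auto simp: H_def c\<nu>)
  have "S = {x. (\<forall>b\<in>Basis. x \<bullet> b \<in> {-1..1}) \<and> x \<bullet> w = 0}"
    unfolding S_def cw by (auto simp: Basis_vec_def inner_axis)
  hence [measurable]: "S \<in> sets borel" by simp
  let ?P = "{c. \<bar>c \<bullet> \<nu>\<bar> < \<tau> \<and> c - (c \<bullet> \<nu>) *\<^sub>R \<nu> \<in> S}"
  let ?Q = "{c::real^'k. (\<forall>b\<in>Basis. \<bar>c \<bullet> b\<bar> \<le> 1 + \<delta>) \<and> \<bar>c \<bullet> w\<bar> < \<eta>}"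
  have P: "emeasure lborel ?P = ennreal (2 * \<tau>) * emeasure (subspace_lborel H) S"
    unfolding H by (intro emeasure_hyperplane_prism \<nu> \<tau>) simp
  have sub: "?P \<subseteq> ?Q"
  proof safe
    fix c assume c: "\<bar>c \<bullet> \<nu>\<bar> < \<tau>" "c - (c \<bullet> \<nu>) *\<^sub>R \<nu> \<in> S"
    have "(c \<bullet> \<nu>) * sqrt d = c \<bullet> w" unfolding c\<nu> cw using d by simp
    moreover have "\<bar>(c \<bullet> \<nu>) * sqrt d\<bar> < \<tau> * sqrt d"
      using c(1) d by (simp add: abs_mult)
    moreover have "\<tau> * sqrt d = \<eta>" using d by (simp add: \<tau>_def)
    ultimately show "\<bar>c \<bullet> w\<bar> < \<eta>" by simp
    fix b :: "real^'k" assume "b \<in> Basis"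
    then obtain i where b: "b = axis i 1" by (auto simp: Basis_vec_def)
    have "\<bar>c $ i - (c \<bullet> \<nu>) / sqrt d\<bar> \<le> 1" using c(2) by (auto simp: S_def \<nu>_def abs_le_iff dest!: spec[of _ i])
    moreover have "\<bar>(c \<bullet> \<nu>) / sqrt d\<bar> \<le> \<eta>"
    proof -
      have "\<bar>(c \<bullet> \<nu>) / sqrt d\<bar> \<le> \<bar>c \<bullet> \<nu>\<bar> / 1" using d by (simp add: abs_divide divide_le_eq mult_right_mono mult_le_cancel_left1)
      also have "\<dots> \<le> \<tau>" using c(1) by simp
      also have "\<tau> \<le> \<eta>" using d \<eta> by (simp add: \<tau>_def divide_le_eq mult_le_cancel_left1)
      finally show ?thesis .
    qed
    ultimately have "\<bar>c $ i\<bar> \<le> 1 + \<delta>" using \<eta> by linarith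
    thus "\<bar>c \<bullet> b\<bar> \<le> 1 + \<delta>" by (simp add: b inner_axis)
  qed
  have Q: "emeasure lborel ?Q = slab (1 + \<delta>) \<eta> (Basis :: (real^'k) set) (\<lambda>_. 1) 0"
    unfolding emeasure_lborel_slab by (intro slab_cong) (auto simp: Basis_vec_def inner_axis w_def)
  have "emeasure lborel ?P \<le> emeasure lborel ?Q" using sub by (intro emeasure_mono) auto
  hence le: "ennreal (2 * \<tau>) * emeasure (subspace_lborel H) S
      \<le> slab (1 + \<delta>) \<eta> (Basis :: (real^'k) set) (\<lambda>_. 1) 0"
    by (simp only: P Q)
  \<comment> \<open>\<open>measure\<close> takes the default value 0 on sets of infinite measure, so
    finiteness is needed before it can replace \<open>emeasure\<close>.\<close>
  have "emeasure lborel ?Q \<le> emeasure lborel (cbox (- (1 + \<delta>) *\<^sub>R One) ((1 + \<delta>) *\<^sub>R One) :: (real^'k) set)"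
    by (intro emeasure_mono) (auto simp: mem_box abs_le_iff minus_le_iff simp del: scaleR_minus_left)
  also have "\<dots> < \<infinity>" by (intro emeasure_lborel_cbox_finite)
  finally have "ennreal (2 * \<tau>) * emeasure (subspace_lborel H) S < \<infinity>"
    using le Q by simp
  hence fin: "emeasure (subspace_lborel H) S \<noteq> \<infinity>"
    using \<tau> by (auto simp: ennreal_mult_top)
  hence eq: "emeasure (subspace_lborel H) S = ennreal (measure (subspace_lborel H) S)"
    by (simp add: emeasure_eq_ennreal_measure)
  show "ennreal (2 * \<eta> / sqrt d * measure (subspace_lborel H) S)
      \<le> slab (1 + \<delta>) \<eta> (Basis :: (real^'k) set) (\<lambda>_. 1) 0"
  proof -
    have "ennreal (2 * \<tau>) * ennreal (measure (subspace_lborel H) S) =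
        ennreal (2 * \<eta> / sqrt d * measure (subspace_lborel H) S)"
      using \<tau> by (subst ennreal_mult[symmetric]) (auto simp: \<tau>_def)
    thus ?thesis using le unfolding eq by simp
  qed
  \<comment> \<open>The bound 1/2 suffices because removing the normal component at most doubles the
    norm by the crude triangle inequality.\<close>
  define e where "e = min \<tau> (1/2)"
  have "ball 0 e \<subseteq> ?P"
  proof
    fix c :: "real^'k" assume "c \<in> ball 0 e"
    hence c: "norm c < \<tau>" "norm c < 1/2" by (auto simp: e_def)
    have "\<bar>c \<bullet> \<nu>\<bar> \<le> norm c" using Cauchy_Schwarz_ineq2[of c \<nu>] \<nu> by simp
    moreover have "norm (c - (c \<bullet> \<nu>) *\<^sub>R \<nu>) \<le> norm c + \<bar>c \<bullet> \<nu>\<bar>"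
      using norm_triangle_ineq4[of c "(c \<bullet> \<nu>) *\<^sub>R \<nu>"] \<nu> by simp
    ultimately have 1: "\<bar>c \<bullet> \<nu>\<bar> < \<tau>" "norm (c - (c \<bullet> \<nu>) *\<^sub>R \<nu>) \<le> 1" using c by auto
    have "(c - (c \<bullet> \<nu>) *\<^sub>R \<nu>) $ i \<in> {-1..1}" for i
      unfolding atLeastAtMost_iff
      using component_le_norm_cart[of "c - (c \<bullet> \<nu>) *\<^sub>R \<nu>" i] 1 by linarith
    moreover have "(c - (c \<bullet> \<nu>) *\<^sub>R \<nu>) \<in> H"
      unfolding H using \<nu> by (simp add: inner_diff_left norm_eq_1)
    ultimately show "c \<in> ?P" using 1 unfolding S_def H_def by blast
  qed
  hence "emeasure lborel (ball (0::real^'k) e) \<le> emeasure lborel ?P" by (intro emeasure_mono) auto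
  moreover have "emeasure lborel (ball (0::real^'k) e) > 0"
    using \<tau> by (simp add: e_def emeasure_ball)
  ultimately have "emeasure lborel ?P \<noteq> 0" by auto
  hence "measure (subspace_lborel H) S \<noteq> 0" unfolding P eq by auto
  thus "0 < measure (subspace_lborel H) S" by (simp add: zero_less_measure_iff)
qed

lemma Delta_pos: "Delta TYPE('k::finite) > 0"
  using subspace_lborel_cube_section(1)[of 1 1, where 'k='k] unfolding Delta_def by simp

text \<open>Undoing the normalisation of \<open>Delta\<close>, the left side is the section volume
  times \<open>2 * \<eta> / sqrt d\<close>, the volume of the prism in the preceding
  estimate.\<close>

lemma Delta_le_slab:
  assumes "finite I" "card I = CARD('k::finite)" "0 < \<eta>" "\<eta> \<le> \<delta>"
  shows "ennreal (2 ^ card I * Delta TYPE('k) * \<eta>) \<le> slab (1 + \<delta>) \<eta> I (\<lambda>_. 1) 0"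
proof -
  have 2: "(2::real) ^ CARD('k) = 2 * 2 ^ (CARD('k) - 1)"
    by (metis power_eq_if zero_less_card_finite less_numeral_extra(3))
  have "2 ^ card I * Delta TYPE('k) * \<eta> = 2 * \<eta> / sqrt (real CARD('k)) *
     measure (subspace_lborel {x :: real^'k. (\<Sum>i\<in>UNIV. x $ i) = 0})
       {x :: real^'k. (\<forall>i. x $ i \<in> {-1..1}) \<and> (\<Sum>i\<in>UNIV. x $ i) = 0}"
    unfolding Delta_def assms 2 by (simp add: field_simps)
  hence "ennreal (2 ^ card I * Delta TYPE('k) * \<eta>) \<le> slab (1 + \<delta>) \<eta> (Basis :: (real^'k) set) (\<lambda>_. 1) 0"
    using subspace_lborel_cube_section(2)[OF assms(3,4), where 'k='k] by simp
  also have "\<dots> = slab (1 + \<delta>) \<eta> I (\<lambda>_. 1) 0"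
    using assms by (intro slab_const_card) auto
  finally show ?thesis .
qed

section \<open>Slab volumes under scaling and shearing\<close>

lemma slab_scale:
  assumes "k > 0"
  shows "slab r (k * \<eta>) I (\<lambda>i. k * w i) (k * t) = slab r \<eta> I w t"
  unfolding slab_def
proof (intro nn_integral_cong arg_cong2[of _ _ _ _ "(*)"] refl)
  fix c
  have "k * t + (\<Sum>i\<in>I. k * w i * c i) = k * (t + (\<Sum>i\<in>I. w i * c i))"
    by (simp add: algebra_simps sum_distrib_left)
  thus "indicator {-(k * \<eta>)<..<k * \<eta>} (k * t + (\<Sum>i\<in>I. k * w i * c i)) =
      (indicator {-\<eta><..<\<eta>} (t + (\<Sum>i\<in>I. w i * c i)) :: ennreal)"
    using assms mult_less_cancel_left_pos[of k "-\<eta>"] by (simp add: indicator_def)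
qed

text \<open>Rescaling coordinate \<open>b\<close> by \<open>c b\<close> turns the box into a cube;
  the determinant comes out in front and the same factors pass to the normal vector.\<close>

lemma emeasure_lborel_weighted_slab:
  fixes w :: "'a::euclidean_space"
  assumes c: "\<And>b. b \<in> Basis \<Longrightarrow> c b > 0"
  shows "emeasure lborel {p. (\<forall>b\<in>Basis. \<bar>p \<bullet> b\<bar> \<le> r * c b) \<and> \<bar>p \<bullet> w\<bar> < \<eta>} =
    ennreal (\<Prod>b\<in>Basis. c b) * slab r \<eta> Basis (\<lambda>b. c b * (w \<bullet> b)) 0"
proof -
  let ?E = "{p. (\<forall>b\<in>Basis. \<bar>p \<bullet> b\<bar> \<le> r * c b) \<and> \<bar>p \<bullet> w\<bar> < \<eta>}"
  define T where "T = (\<lambda>x::'a. 0 + (\<Sum>j\<in>Basis. (c j * (x \<bullet> j)) *\<^sub>R j))"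
  define w' where "w' = (\<Sum>b\<in>Basis. (c b * (w \<bullet> b)) *\<^sub>R b)"
  have [measurable]: "T \<in> borel_measurable borel" unfolding T_def by measurable
  have [measurable]: "?E \<in> sets borel" by measurable
  have "emeasure lborel ?E = emeasure (density (distr lborel borel T) (\<lambda>_. (\<Prod>j\<in>Basis. \<bar>c j\<bar>))) ?E"
    unfolding T_def using c by (subst lborel_affine_euclidean[of c 0]) (auto simp: less_imp_neq[symmetric])
  also have "\<dots> = ennreal (\<Prod>b\<in>Basis. c b) * emeasure lborel (T -` ?E)"
    using c by (simp add: emeasure_density nn_integral_cmult emeasure_distr abs_of_pos cong: prod.cong)
  also have "T -` ?E = {p. (\<forall>b\<in>Basis. \<bar>p \<bullet> b\<bar> \<le> r) \<and> \<bar>p \<bullet> w'\<bar> < \<eta>}"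
  proof -
    have Tb: "T p \<bullet> b = c b * (p \<bullet> b)" if "b \<in> Basis" for p b using that by (simp add: T_def)
    have "T p \<bullet> w = p \<bullet> w'" for p
      by (simp add: T_def w'_def inner_sum_left inner_sum_right inner_commute mult_ac)
    moreover have "\<bar>c b * x\<bar> \<le> r * c b \<longleftrightarrow> \<bar>x\<bar> \<le> r" if "b \<in> Basis" for b x
      using c[OF that] by (simp add: abs_mult mult.commute)
    ultimately show ?thesis by (auto simp: Tb)
  qed
  also have "emeasure lborel \<dots> = slab r \<eta> Basis (\<lambda>b. c b * (w \<bullet> b)) 0"
    unfolding emeasure_lborel_slab by (intro slab_cong) (simp add: w'_def)
  finally show ?thesis .
qed

text \<open>For a fixed second component the shear is a translation by \<open>f y\<close>, so the
  inner integral in Fubini is unchanged.\<close>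

lemma emeasure_lborel_shear:
  fixes S :: "('a::euclidean_space \<times> 'b::euclidean_space) set"
  assumes [measurable]: "S \<in> sets borel" "f \<in> borel_measurable borel"
  shows "emeasure lborel {p. (fst p + f (snd p), snd p) \<in> S} = emeasure lborel S"
proof -
  have meas: "emeasure lborel T = (\<integral>\<^sup>+ y. \<integral>\<^sup>+ x. indicator T (x, y) \<partial>lborel \<partial>lborel)"
    if T: "T \<in> sets borel" for T :: "('a \<times> 'b) set"
  proof -
    have T': "T \<in> sets (lborel \<Otimes>\<^sub>M lborel)" using T by (simp only: lborel_prod sets_lborel)
    have "emeasure lborel T = (\<integral>\<^sup>+ p. indicator T p \<partial>(lborel \<Otimes>\<^sub>M lborel))"
      using T by (simp add: lborel_prod)
    also have "\<dots> = (\<integral>\<^sup>+ y. \<integral>\<^sup>+ x. indicator T (x, y) \<partial>lborel \<partial>lborel)"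
      using T' by (intro lborel_pair.nn_integral_snd[symmetric]) simp
    finally show ?thesis .
  qed
  have "(\<lambda>p::'a\<times>'b. (fst p + f (snd p), snd p)) \<in> borel_measurable borel"
    unfolding borel_prod[symmetric] by measurable
  hence "{p. (fst p + f (snd p), snd p) \<in> S} \<in> sets borel"
    by measurable
  hence "emeasure lborel {p. (fst p + f (snd p), snd p) \<in> S} =
     (\<integral>\<^sup>+ y. \<integral>\<^sup>+ x. indicator S (f y + x, y) \<partial>lborel \<partial>lborel)"
    by (simp add: meas indicator_def add.commute cong: nn_integral_cong)
  also have "\<dots> = (\<integral>\<^sup>+ y. \<integral>\<^sup>+ x. indicator S (x, y) \<partial>lborel \<partial>lborel)"
  proof (rule nn_integral_cong)
    fix y :: 'b
    have S: "S \<in> sets (borel \<Otimes>\<^sub>M borel)" using assms(1) by (simp only: borel_prod)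
    have [measurable]: "(\<lambda>x. indicator S (x, y) :: ennreal) \<in> borel_measurable borel"
      using S by measurable
    have "(\<integral>\<^sup>+ x. indicator S (f y + x, y) \<partial>lborel) =
      (\<integral>\<^sup>+ x. indicator S (x, y) \<partial>distr lborel borel ((+) (f y)))"
      by (subst nn_integral_distr) auto
    thus "(\<integral>\<^sup>+ x. indicator S (f y + x, y) \<partial>lborel) = (\<integral>\<^sup>+ x. indicator S (x, y) \<partial>lborel)"
      by (simp add: lborel_distr_plus)
  qed
  also have "\<dots> = emeasure lborel S" by (rule meas[symmetric]) simp
  finally show ?thesis .
qed

subsection \<open>Transference\<close>

lemma infnorm_le:
  fixes x :: "'a::euclidean_space"
  shows "(\<And>b. b \<in> Basis \<Longrightarrow> \<bar>x \<bullet> b\<bar> \<le> M) \<Longrightarrow> infnorm x \<le> M"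
  by (simp add: infnorm_Max)

lemma int_points_eq_int_vecs: "int_points = (int_vecs :: (real^'k::finite) set)"
  by (auto simp: int_points_def int_vecs_def Basis_vec_def inner_axis)

lemma int_points_Pair:
  "(x, y) \<in> int_points \<longleftrightarrow> x \<in> int_points \<and> y \<in> int_points"
  by (simp add: int_points_def Basis_prod_def ball_Un inner_Pair_0)

text \<open>The strict volume bound leaves the room that Blichfeldt's principle needs, and the
  factor \<open>1 + \<delta>\<close> is the margin by which the cube is enlarged in
  \<open>Delta_le_slab\<close>.\<close>

lemma transference_strict:
  fixes \<Theta> :: "real^'m::finite^'n::finite" and x :: "real^'m" and y :: "real^'n"
    and V Y R \<delta> :: real
  assumes xy: "x \<in> int_vecs" "y \<in> int_vecs" "(x, y) \<noteq> (0, 0)"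
    and pos: "V > 0" "Y > 0" "R > 0" "\<delta> > 0"
    and x: "V * infnorm x \<le> R" and w: "Y * infnorm (\<Theta> *v x + y) \<le> R"
    and vol: "V ^ CARD('m) * Y ^ CARD('n) * Delta TYPE('m + 'n) > R"
  obtains x' :: "real^'m" and y' :: "real^'n"
    where "x' \<in> int_vecs" "y' \<in> int_vecs" "(x', y') \<noteq> (0, 0)"
      "infnorm y' \<le> (1 + \<delta>) * Y" "infnorm (x' - transpose \<Theta> *v y') \<le> (1 + \<delta>) * V"
proof -
  let ?B = "Basis :: ((real^'m) \<times> (real^'n)) set"
  define v where "v = (x, y)"
  define w where "w = (x, \<Theta> *v x + y)"
  have "v \<in> int_points" "v \<noteq> 0"
    using xy by (auto simp: v_def int_points_Pair int_points_eq_int_vecs zero_prod_def)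
  then obtain u g where g: "g \<ge> 1" and u: "u \<bullet> v = g"
    and min: "\<And>z. z \<in> int_points \<Longrightarrow> \<bar>z \<bullet> v\<bar> < g \<Longrightarrow> z \<bullet> v = 0"
    by (rule minimal_inner_product) blast
  \<comment> \<open>\<open>N\<close> is so large that the half-width \<open>g / (N * R)\<close>,
    obtained after scaling the normal vector to unit entries, fits into the margin
    \<open>\<delta>\<close>.\<close>
  obtain N :: nat where N: "real N > g / (R * \<delta>)" using reals_Archimedean2 by blast
  have "g / (R * \<delta>) > 0" using g pos by simp
  hence N0: "N > 0" using N by (cases N) auto
  have N\<delta>: "g / (N * R) \<le> \<delta>" using N N0 pos by (simp add: field_simps)
  define \<eta> where "\<eta> = g / (2 * N)"
  \<comment> \<open>On a basis vector exactly one norm is 1 and the other is 0, so \<open>c\<close>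
    is \<open>V/2\<close> on the first block and \<open>Y/2\<close> on the second. The halves are
    there because the lattice point will be a difference of two points of the body.\<close>
  define c where "c = (\<lambda>p::(real^'m) \<times> (real^'n). norm (fst p) * (V/2) + norm (snd p) * (Y/2))"
  have B: "b \<in> ?B \<longleftrightarrow> (\<exists>b'\<in>Basis. b = (b', 0)) \<or> (\<exists>b'\<in>Basis. b = (0, b'))" for b
    by (auto simp: Basis_prod_def)
  have c1: "c (b, 0) = V / 2" if "b \<in> Basis" for b using that by (simp add: c_def)
  have c2: "c (0, b) = Y / 2" if "b \<in> Basis" for b using that by (simp add: c_def)
  have c_pos: "c b > 0" if "b \<in> ?B" for b using that pos by (auto simp: B c1 c2)
  have prod_c: "(\<Prod>b\<in>?B. c b) = (V/2) ^ CARD('m) * (Y/2) ^ CARD('n)"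
  proof -
    have "(\<Prod>b\<in>?B. c b) = (\<Prod>b\<in>(Basis :: (real^'m) set). c (b, 0)) * (\<Prod>b\<in>(Basis :: (real^'n) set). c (0, b))"
      unfolding Basis_prod_def
      by (subst prod.union_disjoint) (auto simp: prod.reindex inj_on_def)
    thus ?thesis by (simp add: c1 c2)
  qed
  define E where "E = {p. (\<forall>b\<in>Basis. \<bar>p \<bullet> b\<bar> \<le> (1 + \<delta>) * c b) \<and> \<bar>p \<bullet> w\<bar> < \<eta>}"
  have [measurable]: "E \<in> sets borel" unfolding E_def by measurable
  define f where "f = (\<lambda>q. - (transpose \<Theta> *v q))"
  have f [measurable]: "f \<in> borel_measurable borel"
    unfolding f_def
    by (intro borel_measurable_uminus borel_measurable_continuous_onI linear_continuous_on
        matrix_vector_mul_bounded_linear)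
  \<comment> \<open>\<open>A\<close> is the preimage under the shear of the box slab
    \<open>E\<close>, so it has the same volume.\<close>
  define A where "A = {p. (fst p + f (snd p), snd p) \<in> E}"
  have "(\<lambda>p::(real^'m) \<times> (real^'n). (fst p + f (snd p), snd p)) \<in> borel_measurable borel"
    unfolding borel_prod[symmetric] by measurable
  hence A_sets: "A \<in> sets borel" unfolding A_def by measurable
  have "ennreal (1 / N) < emeasure lborel A"
  proof -
    have wb: "\<bar>c b * (w \<bullet> b)\<bar> \<le> \<bar>R/2 * 1\<bar>" if "b \<in> ?B" for b
      using that unfolding B
    proof (elim disjE bexE)
      fix b' :: "real^'m" assume b': "b' \<in> Basis" "b = (b', 0)"
      have "V * \<bar>x \<bullet> b'\<bar> \<le> V * infnorm x" using pos b' by (intro mult_left_mono Basis_le_infnorm) auto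
      hence "V * \<bar>x \<bullet> b'\<bar> \<le> R" using x by (rule order_trans)
      thus ?thesis using b' pos by (simp add: c1 w_def abs_mult)
    next
      fix b' :: "real^'n" assume b': "b' \<in> Basis" "b = (0, b')"
      have "Y * \<bar>(\<Theta> *v x + y) \<bullet> b'\<bar> \<le> Y * infnorm (\<Theta> *v x + y)"
        using pos b' by (intro mult_left_mono Basis_le_infnorm) auto
      hence "Y * \<bar>(\<Theta> *v x + y) \<bullet> b'\<bar> \<le> R" using w by (rule order_trans)
      thus ?thesis using b' pos by (simp add: c2 w_def abs_mult)
    qed
    have \<eta>: "\<eta> = R/2 * (g / (N * R))" using pos N0 by (simp add: \<eta>_def)
    \<comment> \<open>The powers of 2 from the halved box cancel the factor in
      \<open>Delta_le_slab\<close>; what remains is \<open>vol\<close> together with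
      \<open>g \<ge> 1\<close>.\<close>
    have "1 / N < (V/2) ^ CARD('m) * (Y/2) ^ CARD('n) *
        (2 ^ (CARD('m) + CARD('n)) * Delta TYPE('m + 'n) * (g / (N * R)))"
    proof -
      have "1 / N \<le> R * (g / (N * R))" using g pos N0 by (simp add: field_simps)
      also have "\<dots> < V ^ CARD('m) * Y ^ CARD('n) * Delta TYPE('m + 'n) * (g / (N * R))"
        using vol g pos N0 by (intro mult_strict_right_mono) auto
      also have "\<dots> = (V/2) ^ CARD('m) * (Y/2) ^ CARD('n) *
        (2 ^ (CARD('m) + CARD('n)) * Delta TYPE('m + 'n) * (g / (N * R)))"
        by (simp add: power_divide power_add)
      finally show ?thesis .
    qed
    hence "ennreal (1 / N) < ennreal ((V/2) ^ CARD('m) * (Y/2) ^ CARD('n)) *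
        ennreal (2 ^ (CARD('m) + CARD('n)) * Delta TYPE('m + 'n) * (g / (N * R)))"
      using pos g Delta_pos[where 'k="'m + 'n"]
      by (subst ennreal_mult[symmetric]) (auto intro!: ennreal_lessI mult_nonneg_nonneg mult_pos_pos simp: less_imp_le N0)
    also have "\<dots> \<le> ennreal ((V/2) ^ CARD('m) * (Y/2) ^ CARD('n)) * slab (1 + \<delta>) (g / (N * R)) ?B (\<lambda>_. 1) 0"
      using Delta_le_slab[of ?B "g / (N * R)" \<delta>, where 'k="'m + 'n"] g pos N0 N\<delta>
      by (intro mult_left_mono) auto
    also have "slab (1 + \<delta>) (g / (N * R)) ?B (\<lambda>_. 1) 0 = slab (1 + \<delta>) \<eta> ?B (\<lambda>_. R/2 * 1) 0"
      using slab_scale[of "R/2" "1 + \<delta>" "g / (N * R)" ?B "\<lambda>_. 1" 0] pos by (simp only: \<eta>) simp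
    also have "\<dots> \<le> slab (1 + \<delta>) \<eta> ?B (\<lambda>b. c b * (w \<bullet> b)) 0"
      using wb by (intro slab_0_antimono) auto
    also have "ennreal ((V/2) ^ CARD('m) * (Y/2) ^ CARD('n)) * \<dots> = emeasure lborel E"
      unfolding E_def by (subst emeasure_lborel_weighted_slab) (auto simp: prod_c c_pos)
    also have "\<dots> = emeasure lborel A"
      unfolding A_def by (intro emeasure_lborel_shear[symmetric]) auto
    finally show ?thesis by (simp add: mult_left_mono)
  qed
  \<comment> \<open>By adjointness the shear turns inner products with \<open>v\<close> into those
    with \<open>w\<close>, so the slab of \<open>E\<close> normal to \<open>w\<close> is a slab of
    \<open>A\<close> normal to \<open>v\<close>.\<close>
  moreover have av: "p \<bullet> v = (fst p + f (snd p), snd p) \<bullet> w" for p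
  proof -
    have "(transpose \<Theta> *v snd p) \<bullet> x = snd p \<bullet> (\<Theta> *v x)"
      by (metis dot_lmul_matrix transpose_matrix_vector transpose_transpose)
    thus ?thesis by (simp add: v_def w_def f_def inner_prod_def inner_diff_left inner_add_right inner_add_left)
  qed
  ultimately obtain a a' where a: "a \<in> A" "a' \<in> A" "a \<noteq> a'" "a - a' \<in> int_points"
    using blichfeldt_slab[OF A_sets _ N0 _ u min] g
    by (force simp: A_def E_def \<eta>_def)
  define x' y' where "x' = fst (a - a')" and "y' = snd (a - a')"
  have z: "a - a' = (x', y')" by (simp only: x'_def y'_def prod.collapse)
  have int: "x' \<in> int_vecs" "y' \<in> int_vecs"
    using a(4) unfolding z by (auto simp: int_points_Pair int_points_eq_int_vecs)
  have "(x', y') \<noteq> (0, 0)" using a(3) unfolding z[symmetric] zero_prod_def[symmetric] by simp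
  moreover have "infnorm y' \<le> (1 + \<delta>) * Y"
  proof (rule infnorm_le)
    fix b :: "real^'n" assume b: "b \<in> Basis"
    have "\<bar>snd p \<bullet> b\<bar> \<le> (1 + \<delta>) * (Y/2)" if "p \<in> A" for p
    proof -
      have "(0, b) \<in> ?B" using b by (simp add: B)
      thus ?thesis using that c2[OF b] by (fastforce simp: A_def E_def)
    qed
    from this[OF a(1)] this[OF a(2)] show "\<bar>y' \<bullet> b\<bar> \<le> (1 + \<delta>) * Y"
      by (simp add: y'_def inner_diff_left)
  qed
  moreover have "infnorm (x' - transpose \<Theta> *v y') \<le> (1 + \<delta>) * V"
  proof (rule infnorm_le)
    fix b :: "real^'m" assume b: "b \<in> Basis"
    have *: "\<bar>(fst p - transpose \<Theta> *v snd p) \<bullet> b\<bar> \<le> (1 + \<delta>) * (V/2)" if "p \<in> A" for p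
    proof -
      have "(b, 0) \<in> ?B" using b by (simp add: B)
      thus ?thesis using that c1[OF b] by (fastforce simp: A_def E_def f_def)
    qed
    have "(x' - transpose \<Theta> *v y') \<bullet> b =
      (fst a - transpose \<Theta> *v snd a) \<bullet> b - (fst a' - transpose \<Theta> *v snd a') \<bullet> b"
      by (simp add: x'_def y'_def matrix_vector_mult_diff_distrib inner_diff_left)
    thus "\<bar>(x' - transpose \<Theta> *v y') \<bullet> b\<bar> \<le> (1 + \<delta>) * V"
      using *[OF a(1)] *[OF a(2)] by simp
  qed
  ultimately show ?thesis using int that by blast
qed

text \<open>For \<open>\<delta> < 1\<close> all candidates lie in one finite set. If each violated a
  limiting bound, each would also fail for all small \<open>\<delta>\<close>, hence all at once. The
  square combines two enlargements, one making the volume inequality strict and one from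
  \<open>transference_strict\<close>.\<close>

lemma transference_limit:
  fixes \<Theta> :: "real^'m::finite^'n::finite" and V Y :: real
  assumes pos: "V > 0" "Y > 0"
    and approx: "\<And>\<delta>::real. \<delta> > 0 \<Longrightarrow> \<exists>(x :: real^'m) (y :: real^'n). x \<in> int_vecs \<and> y \<in> int_vecs \<and>
      (x, y) \<noteq> (0, 0) \<and> infnorm y \<le> (1 + \<delta>)^2 * Y \<and> infnorm (x - transpose \<Theta> *v y) \<le> (1 + \<delta>)^2 * V"
  shows "\<exists>(x :: real^'m) (y :: real^'n). x \<in> int_vecs \<and> y \<in> int_vecs \<and>
      (x, y) \<noteq> (0, 0) \<and> infnorm y \<le> Y \<and> infnorm (x - transpose \<Theta> *v y) \<le> V"
proof (rule ccontr)
  assume no: "\<not> ?thesis"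
  define P where "P = (\<lambda>(\<delta>::real) (x :: real^'m, y :: real^'n).
     infnorm y \<le> (1 + \<delta>)^2 * Y \<and> infnorm (x - transpose \<Theta> *v y) \<le> (1 + \<delta>)^2 * V)"
  have lin: "linear ((*v) (transpose \<Theta>))" by simp
  then obtain K where K: "K > 0" "\<And>y. norm (transpose \<Theta> *v y) \<le> K * norm y"
    using linear_bounded_pos by blast
  \<comment> \<open>For \<open>\<delta> < 1\<close> the factor is at most 4. The first summand
    bounds the entries of \<open>y\<close>, the second those of \<open>x\<close> by way of the
    operator bound \<open>K\<close>; their sum serves both.\<close>
  define M where "M = 4 * Y + (4 * V + K * (sqrt CARD('n) * (4 * Y)))"
  define F where "F = {z \<in> int_points. \<forall>b\<in>Basis. \<bar>z \<bullet> b\<bar> \<le> M} - {0 :: (real^'m) \<times> (real^'n)}"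
  have "finite F" unfolding F_def using finite_int_points_bounded by blast
  have "eventually (\<lambda>\<delta>. \<not> P \<delta> z) (at_right 0)" if z: "z \<in> F" for z
  proof -
    obtain x y where xy: "z = (x, y)" by (cases z)
    have "x \<in> int_vecs" "y \<in> int_vecs" "(x, y) \<noteq> (0, 0)"
      using z by (auto simp: F_def xy int_points_Pair int_points_eq_int_vecs zero_prod_def)
    with no have *: "infnorm y > Y \<or> infnorm (x - transpose \<Theta> *v y) > V" by force
    have lim: "((\<lambda>\<delta>::real. (1 + \<delta>)^2 * C) \<longlongrightarrow> (1 + 0)^2 * C) (at_right 0)" for C :: real
      by (intro tendsto_intros)
    have ev: "eventually (\<lambda>\<delta>. (1 + \<delta>)^2 * C < D) (at_right 0)" if "C < D" for C D :: real
      using order_tendstoD(2)[OF lim[of C], of D] that by simp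
    from * show ?thesis
    proof
      assume "infnorm y > Y"
      from ev[OF this] show ?thesis by eventually_elim (simp add: P_def xy)
    next
      assume "infnorm (x - transpose \<Theta> *v y) > V"
      from ev[OF this] show ?thesis by eventually_elim (simp add: P_def xy)
    qed
  qed
  hence "eventually (\<lambda>\<delta>. \<forall>z\<in>F. \<not> P \<delta> z) (at_right 0)"
    using \<open>finite F\<close> by (intro eventually_ball_finite) auto
  moreover have "eventually (\<lambda>\<delta>. \<delta> \<in> {0<..<1}) (at_right (0::real))"
    by (rule eventually_at_right_real) simp
  ultimately have "eventually (\<lambda>\<delta>. \<delta> \<in> {0<..<1} \<and> (\<forall>z\<in>F. \<not> P \<delta> z)) (at_right 0)"
    by eventually_elim auto
  hence "\<exists>\<delta>. \<delta> \<in> {0<..<1} \<and> (\<forall>z\<in>F. \<not> P \<delta> z)"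
    by (rule eventually_happens'[OF trivial_limit_at_right_real])
  then obtain \<delta> where \<delta>: "0 < \<delta>" "\<delta> < 1" and notP: "\<forall>z\<in>F. \<not> P \<delta> z" by auto
  obtain x :: "real^'m" and y :: "real^'n" where xy: "x \<in> int_vecs" "y \<in> int_vecs"
      "(x, y) \<noteq> (0, 0)" "infnorm y \<le> (1 + \<delta>)^2 * Y" "infnorm (x - transpose \<Theta> *v y) \<le> (1 + \<delta>)^2 * V"
    using approx[OF \<delta>(1)] by blast
  have "(1 + \<delta>)^2 \<le> 2^2" using \<delta> by (intro power_mono) auto
  hence "(1 + \<delta>)^2 * Y \<le> 4 * Y" "(1 + \<delta>)^2 * V \<le> 4 * V" using pos by auto
  hence y: "infnorm y \<le> 4 * Y" and x: "infnorm (x - transpose \<Theta> *v y) \<le> 4 * V" using xy by linarith+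
  have "norm y \<le> sqrt CARD('n) * (4 * Y)"
    using norm_le_infnorm[of y] y by (auto intro: order_trans mult_left_mono)
  hence "norm (transpose \<Theta> *v y) \<le> K * (sqrt CARD('n) * (4 * Y))"
    using K by (meson order_trans mult_le_cancel_left_pos)
  hence "infnorm (transpose \<Theta> *v y) \<le> K * (sqrt CARD('n) * (4 * Y))"
    using infnorm_le_norm order_trans by blast
  moreover have "infnorm x \<le> infnorm (x - transpose \<Theta> *v y) + infnorm (transpose \<Theta> *v y)"
    using infnorm_triangle[of "x - transpose \<Theta> *v y" "transpose \<Theta> *v y"] by simp
  ultimately have x': "infnorm x \<le> 4 * V + K * (sqrt CARD('n) * (4 * Y))" using x by linarith
  have "(x, y) \<in> F"
  proof -
    have "\<bar>(x, y) \<bullet> b\<bar> \<le> M" if "b \<in> Basis" for b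
    proof -
      have 1: "4 * Y \<ge> 0" "4 * V + K * (sqrt CARD('n) * (4 * Y)) \<ge> 0" using pos K by auto
      from that consider b' where "b' \<in> Basis" "b = (b', 0)" | b' where "b' \<in> Basis" "b = (0, b')"
        by (auto simp: Basis_prod_def)
      thus ?thesis
      proof cases
        case 1
        thus ?thesis using Basis_le_infnorm[of b' x] x' \<open>4 * Y \<ge> 0\<close> by (simp add: M_def)
      next
        case 2
        thus ?thesis using Basis_le_infnorm[of b' y] y 1 by (simp add: M_def)
      qed
    qed
    thus ?thesis using xy by (auto simp: F_def int_points_Pair int_points_eq_int_vecs zero_prod_def)
  qed
  with notP xy show False by (auto simp: P_def)
qed

theorem theorem7:
  fixes \<Theta> :: "real^'m::finite^'n::finite" and X U Y V :: real and n m d :: nat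
  assumes n: "n = CARD('n)" and m: "m = CARD('m)" and d: "d = n + m"
    and "X > 0" and "U > 0"
    and "\<exists>(x :: real^'m) (y :: real^'n). x \<in> int_vecs \<and> y \<in> int_vecs \<and> (x, y) \<noteq> (0, 0) \<and>
           infnorm x \<le> X \<and> infnorm (\<Theta> *v x + y) \<le> U"
    and Y: "Y = Delta TYPE('m + 'n) powr (- 1 / (real d - 1)) *
             (X ^ m * U powi (1 - int m)) powr (1 / (real d - 1))"
    and V: "V = Delta TYPE('m + 'n) powr (- 1 / (real d - 1)) *
             (X powi (1 - int n) * U ^ n) powr (1 / (real d - 1))"
  shows "\<exists>(x :: real^'m) (y :: real^'n). x \<in> int_vecs \<and> y \<in> int_vecs \<and> (x, y) \<noteq> (0, 0) \<and>
           infnorm y \<le> Y \<and> infnorm (x - transpose \<Theta> *v y) \<le> V"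
proof -
  define D where "D = Delta TYPE('m + 'n)"
  have D: "D > 0" unfolding D_def by (rule Delta_pos)
  have nm: "n \<ge> 1" "m \<ge> 1" using n m by (simp_all add: Suc_leI)
  define e where "e = 1 / (real d - 1)"
  define R where "R = D powr (- e) * (X ^ m * U ^ n) powr e"
  have V': "V = D powr (- e) * (X powi (1 - int n) * U ^ n) powr e"
    and Y': "Y = D powr (- e) * (X ^ m * U powi (1 - int m)) powr e"
    by (simp_all add: V Y D_def e_def)
  note XU = \<open>X > 0\<close> \<open>U > 0\<close>
  have d1: "real d - 1 = real (d - 1)" "real (d - 1) > 0" using nm d by (auto simp: of_nat_diff)
  have root: "(a ^ (d - 1)) powr e = a" if "a > 0" for a
    using that d1 by (simp add: e_def powr_powr flip: powr_realpow)
  have pos: "V > 0" "Y > 0" "R > 0" using XU D by (simp_all add: V' Y' R_def)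
  \<comment> \<open>The exponent \<open>1 - int k\<close> may be zero or negative. The factor
    \<open>a ^ (d - 1)\<close>, which comes from writing \<open>a\<close> as its \<open>e\<close>-th
    power, makes it natural again.\<close>
  have powi: "a powi (1 - int k) * a ^ (d - 1) = a ^ (d - k)" if "a > 0" "k \<le> d" for a :: real and k
  proof -
    have "a powi (1 - int k) * a ^ (d - 1) = a powi ((1 - int k) + int (d - 1))"
      using that by (subst power_int_add) auto
    also have "(1 - int k) + int (d - 1) = int (d - k)" using that nm d by (simp add: of_nat_diff)
    finally show ?thesis by simp
  qed
  have VX: "V * X = R"
  proof -
    have "V * X = D powr (- e) * ((X powi (1 - int n) * U ^ n) powr e * (X ^ (d - 1)) powr e)"
      by (simp only: V' root[OF XU(1)] mult.assoc)
    also have "(X powi (1 - int n) * U ^ n) powr e * (X ^ (d - 1)) powr e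
        = ((X powi (1 - int n) * X ^ (d - 1)) * U ^ n) powr e"
      using XU by (subst powr_mult[symmetric]) (auto simp: mult_ac)
    also have "X powi (1 - int n) * X ^ (d - 1) = X ^ m" using powi[of X n] XU d by simp
    finally show ?thesis by (simp add: R_def)
  qed
  have YU: "Y * U = R"
  proof -
    have "Y * U = D powr (- e) * ((X ^ m * U powi (1 - int m)) powr e * (U ^ (d - 1)) powr e)"
      by (simp only: Y' root[OF XU(2)] mult.assoc)
    also have "(X ^ m * U powi (1 - int m)) powr e * (U ^ (d - 1)) powr e
        = (X ^ m * (U powi (1 - int m) * U ^ (d - 1))) powr e"
      using XU by (subst powr_mult[symmetric]) (auto simp: mult_ac)
    also have "U powi (1 - int m) * U ^ (d - 1) = U ^ n" using powi[of U m] XU d by simp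
    finally show ?thesis by (simp add: R_def)
  qed
  \<comment> \<open>Together with \<open>V * X = Y * U = R\<close> this yields
    \<open>V ^ m * Y ^ n * D = R\<close> after cancelling \<open>X ^ m * U ^ n\<close>.\<close>
  have "R ^ (d - 1) * D = X ^ m * U ^ n"
  proof -
    have ed: "e * real (d - 1) = 1" using d1 by (simp add: e_def)
    have "R ^ (d - 1) = D powr (- (e * real (d - 1))) * (X ^ m * U ^ n) powr (e * real (d - 1))"
      using D XU by (simp add: R_def power_mult_distrib powr_powr flip: powr_realpow)
    also have "\<dots> = X ^ m * U ^ n / D"
      unfolding ed using D XU by (simp add: powr_minus divide_inverse mult.commute)
    finally show ?thesis using D by simp
  qed
  moreover have "(V * X) ^ m * (Y * U) ^ n = R * R ^ (d - 1)"
    unfolding VX YU using nm by (simp add: d add.commute[of n] flip: power_add power_Suc)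
  ultimately have "(V ^ m * Y ^ n * D) * (X ^ m * U ^ n) = R * (X ^ m * U ^ n)"
    by (simp add: power_mult_distrib mult_ac)
  hence vol: "V ^ m * Y ^ n * D = R" using XU by simp
  obtain x :: "real^'m" and y :: "real^'n" where xy: "x \<in> int_vecs" "y \<in> int_vecs" "(x, y) \<noteq> (0, 0)"
      "infnorm x \<le> X" "infnorm (\<Theta> *v x + y) \<le> U"
    using assms(6) by blast
  show ?thesis
  proof (rule transference_limit[OF pos(1,2)])
    fix \<delta> :: real assume \<delta>: "\<delta> > 0"
    let ?k = "1 + \<delta>"
    have 1: "?k * V * infnorm x \<le> ?k * R"
      using \<delta> pos xy mult_left_mono[of "infnorm x" X V] VX by (simp add: mult.assoc)
    have 2: "?k * Y * infnorm (\<Theta> *v x + y) \<le> ?k * R"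
      using \<delta> pos xy mult_left_mono[of "infnorm (\<Theta> *v x + y)" U Y] YU by (simp add: mult.assoc)
    \<comment> \<open>Enlarging \<open>V\<close>, \<open>Y\<close> and \<open>R\<close> by the same
      factor keeps the two norm bounds but multiplies the volume by a higher power, as
      \<open>m + n \<ge> 2\<close>; so equality becomes strict inequality.\<close>
    have "?k ^ 1 < ?k ^ (m + n)" using \<delta> nm by (intro power_strict_increasing) auto
    hence "?k * R < ?k ^ (m + n) * (V ^ m * Y ^ n * D)" using pos by (simp add: vol)
    hence 3: "?k * R < (?k * V) ^ CARD('m) * (?k * Y) ^ CARD('n) * Delta TYPE('m + 'n)"
      by (simp add: n m D_def power_mult_distrib power_add mult_ac)
    show "\<exists>(x :: real^'m) (y :: real^'n). x \<in> int_vecs \<and> y \<in> int_vecs \<and>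
      (x, y) \<noteq> (0, 0) \<and> infnorm y \<le> ?k^2 * Y \<and> infnorm (x - transpose \<Theta> *v y) \<le> ?k^2 * V"
      by (rule transference_strict[OF xy(1-3) _ _ _ \<delta> 1 2 3])
         (use \<delta> pos in \<open>auto simp: power2_eq_square mult.assoc\<close>)
  qed
qed

end
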